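(* Let $k$ be a field of characteristic not $2$ with $\imath=\sqrt{-1}\in k$, and let $\mathbf{q}$ be a nondegenerate quadratic form on an $n$-dimensional $k$-vector space $V$ with orthogonal basis $e_1,\dots,e_n$, $\mathbf{q}(e_i)=q_i\neq0$. Then $C(V\oplus V,\mathbf{q}\oplus\mathbf{q})\cong C(V,\mathbf{q})\,\underline{\otimes}\,C(V,\mathbf{q})$ acts on $C(V,\mathbf{q})$ by $$(e_x\otimes e_y).e_z=e_x\cdot e_y\cdot e_z\,(-1)^{y\cdot z}\imath^{\rho(y)}=e_{x+y+z}F(x,y)F(x+y,z)(-1)^{y\cdot z}\imath^{\rho(y)}$$ for $x,y,z\in\mathbb{Z}_2^n$, where $\rho(y)=y\cdot y\in\mathbb{Z}$. Moreover, the action is irreducible and yields an isomorphism $$C(V\oplus V,\mathbf{q}\oplus\mathbf{q})\cong\mathrm{End}(C(V,\mathbf{q})).$$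
   Context: $C(V,\mathbf{q})$ is the associative unital algebra generated by $e_1,\dots,e_n$ with relations $e_i^2=q_i\cdot1$, $e_ie_j+e_je_i=0$ for $i\neq j$. For $x\in\mathbb{Z}_2^n$ (components represented by $0,1$), $e_x=e_1^{x_1}\cdots e_n^{x_n}$; these form a basis with $e_x\cdot e_y=F(x,y)e_{x+y}$, where $F(x,y)=(-1)^{\sum_{j<i}x_iy_j}\prod_{i=1}^nq_i^{x_iy_i}$. $\rho(x)=\sum_ix_i\in\mathbb{Z}$ and $x\cdot y=\sum_ix_iy_i$. $C(V,\mathbf{q})$ is a super algebra with $e_x$ of degree $\rho(x)$ mod $2$, and $\underline{\otimes}$ is the super tensor product, $(a\otimes c)(b\otimes d)=(-1)^{\rho(c)\rho(b)}ab\otimes cd$. $\mathbf{q}\oplus\mathbf{q}$ is the quadratic form on $V\oplus V$ for which the two summands are orthogonal, and the identification $C(V\oplus V,\mathbf{q}\oplus\mathbf{q})\cong C(V,\mathbf{q})\,\underline{\otimes}\,C(V,\mathbf{q})$ sends the basis vectors $e_i$ of the first copy of $V$ to $e_i\otimes1$ and those of the second copy to $1\otimes e_i$. $\mathrm{End}$ denotes $k$-linear endomorphisms. *)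

theory Defs
  imports Complex_Main "HOL-Algebra.QuotRing" "HOL-Algebra.Module" "HOL-Library.Poly_Mapping"
begin

section \<open>Quadratic forms\<close>

text \<open>A vector space over the field \<open>'k\<close> is given by a scalar multiplication on a whole type,
  as in the locale \<^locale>\<open>vector_space\<close>.\<close>

definition polar :: "('v::ab_group_add \<Rightarrow> 'k::field) \<Rightarrow> 'v \<Rightarrow> 'v \<Rightarrow> 'k" where
  "polar Q v w = Q (v + w) - Q v - Q w"

definition quadratic_form :: "('k::field \<Rightarrow> 'v::ab_group_add \<Rightarrow> 'v) \<Rightarrow> ('v \<Rightarrow> 'k) \<Rightarrow> bool" where
  "quadratic_form scale Q \<longleftrightarrow>
     (\<forall>c v. Q (scale c v) = c\<^sup>2 * Q v) \<and>
     (\<forall>v. Vector_Spaces.linear scale (*) (\<lambda>w. polar Q v w)) \<and>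
     (\<forall>w. Vector_Spaces.linear scale (*) (\<lambda>v. polar Q v w))"

text \<open>Nondegeneracy of the polar form; this is the usual notion outside characteristic 2.\<close>

definition nondegenerate :: "('v::ab_group_add \<Rightarrow> 'k::field) \<Rightarrow> bool" where
  "nondegenerate Q \<longleftrightarrow> (\<forall>v. (\<forall>w. polar Q v w = 0) \<longrightarrow> v = 0)"

text \<open>The basis vectors \<open>e\<^sub>1, \<dots>, e\<^sub>n\<close> are indexed here by \<open>0, \<dots>, n - 1\<close>.\<close>

definition orthogonal_basis ::
    "('k::field \<Rightarrow> 'v::ab_group_add \<Rightarrow> 'v) \<Rightarrow> ('v \<Rightarrow> 'k) \<Rightarrow> nat \<Rightarrow> (nat \<Rightarrow> 'v) \<Rightarrow> bool" where
  "orthogonal_basis scale Q n e \<longleftrightarrow>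
     inj_on e {..<n} \<and>
     \<not> module.dependent scale (e ` {..<n}) \<and>
     module.span scale (e ` {..<n}) = UNIV \<and>
     (\<forall>i<n. \<forall>j<n. i \<noteq> j \<longrightarrow> polar Q (e i) (e j) = 0)"

definition form_sum :: "('v \<Rightarrow> 'k::field) \<Rightarrow> ('w \<Rightarrow> 'k) \<Rightarrow> 'v \<times> 'w \<Rightarrow> 'k" where
  "form_sum Q Q' = (\<lambda>(v, w). Q v + Q' w)"


section \<open>Algebras over a field\<close>

text \<open>Algebras are records of type \<^typ>\<open>('k, 'a) module\<close>, which contain a ring together with a
  scalar multiplication; the scalars come from a type of class \<^class>\<open>field\<close>.\<close>

definition alg_iso :: "('k::field, 'a, 'm) module_scheme \<Rightarrow> ('k, 'b, 'l) module_scheme \<Rightarrow> ('a \<Rightarrow> 'b) set"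
  where
  "alg_iso A B = {h \<in> ring_iso A B. \<forall>c. \<forall>x\<in>carrier A. h (c \<odot>\<^bsub>A\<^esub> x) = c \<odot>\<^bsub>B\<^esub> h x}"

definition End_alg :: "('k::field, 'a, 'm) module_scheme \<Rightarrow> ('k, 'a \<Rightarrow> 'a) module" where
  "End_alg M =
     \<lparr>carrier = {f \<in> carrier M \<rightarrow>\<^sub>E carrier M.
         (\<forall>x\<in>carrier M. \<forall>y\<in>carrier M. f (x \<oplus>\<^bsub>M\<^esub> y) = f x \<oplus>\<^bsub>M\<^esub> f y) \<and>
         (\<forall>c. \<forall>x\<in>carrier M. f (c \<odot>\<^bsub>M\<^esub> x) = c \<odot>\<^bsub>M\<^esub> f x)},
      mult = compose (carrier M),
      one = (\<lambda>x\<in>carrier M. x),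
      zero = (\<lambda>x\<in>carrier M. \<zero>\<^bsub>M\<^esub>),
      add = (\<lambda>f g. \<lambda>x\<in>carrier M. f x \<oplus>\<^bsub>M\<^esub> g x),
      smult = (\<lambda>c f. \<lambda>x\<in>carrier M. c \<odot>\<^bsub>M\<^esub> f x)\<rparr>"

text \<open>\<open>act\<close> is a left action of the unital algebra \<open>A\<close> on the vector space underlying \<open>M\<close>.\<close>

definition alg_action ::
    "('k::field, 'a, 'm) module_scheme \<Rightarrow> ('k, 'b, 'l) module_scheme \<Rightarrow> ('a \<Rightarrow> 'b \<Rightarrow> 'b) \<Rightarrow> bool" where
  "alg_action A M act \<longleftrightarrow>
     (\<forall>a\<in>carrier A. \<forall>m\<in>carrier M. act a m \<in> carrier M) \<and>
     (\<forall>a\<in>carrier A. \<forall>m\<in>carrier M. \<forall>m'\<in>carrier M.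
        act a (m \<oplus>\<^bsub>M\<^esub> m') = act a m \<oplus>\<^bsub>M\<^esub> act a m') \<and>
     (\<forall>c. \<forall>a\<in>carrier A. \<forall>m\<in>carrier M. act a (c \<odot>\<^bsub>M\<^esub> m) = c \<odot>\<^bsub>M\<^esub> act a m) \<and>
     (\<forall>a\<in>carrier A. \<forall>a'\<in>carrier A. \<forall>m\<in>carrier M.
        act (a \<oplus>\<^bsub>A\<^esub> a') m = act a m \<oplus>\<^bsub>M\<^esub> act a' m) \<and>
     (\<forall>c. \<forall>a\<in>carrier A. \<forall>m\<in>carrier M. act (c \<odot>\<^bsub>A\<^esub> a) m = c \<odot>\<^bsub>M\<^esub> act a m) \<and>
     (\<forall>a\<in>carrier A. \<forall>a'\<in>carrier A. \<forall>m\<in>carrier M. act (a \<otimes>\<^bsub>A\<^esub> a') m = act a (act a' m)) \<and>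
     (\<forall>m\<in>carrier M. act \<one>\<^bsub>A\<^esub> m = m)"

definition irreducible_action ::
    "('k::field, 'a, 'm) module_scheme \<Rightarrow> ('k, 'b, 'l) module_scheme \<Rightarrow> ('a \<Rightarrow> 'b \<Rightarrow> 'b) \<Rightarrow> bool" where
  "irreducible_action A M act \<longleftrightarrow>
     carrier M \<noteq> {\<zero>\<^bsub>M\<^esub>} \<and>
     (\<forall>W. subgroup W (add_monoid M) \<and> (\<forall>c. \<forall>w\<in>W. c \<odot>\<^bsub>M\<^esub> w \<in> W) \<and>
          (\<forall>a\<in>carrier A. \<forall>w\<in>W. act a w \<in> W) \<longrightarrow>
          W = {\<zero>\<^bsub>M\<^esub>} \<or> W = carrier M)"


section \<open>Clifford algebras\<close>

text \<open>Words form the free monoid, written additively because the convolution product of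
  \<open>\<Rightarrow>\<^sub>0\<close> is defined for additive monoids.  So the ring \<open>'g fword \<Rightarrow>\<^sub>0 'k\<close> is the free
  associative unital algebra on the type \<open>'g\<close>.\<close>

datatype 'g fword = FWord (letters: "'g list")

instantiation fword :: (type) monoid_add
begin
definition "0 = FWord []"
definition "u + v = FWord (letters u @ letters v)"
instance by standard (auto simp: zero_fword_def plus_fword_def)
end

definition free_alg :: "'g set \<Rightarrow> ('k::field, 'g fword \<Rightarrow>\<^sub>0 'k) module" where
  "free_alg B =
     \<lparr>carrier = {p. \<forall>w\<in>Poly_Mapping.keys p. set (letters w) \<subseteq> B},
      mult = (*), one = 1, zero = 0, add = (+), smult = (\<lambda>c p. Poly_Mapping.map ((*) c) p)\<rparr>"

definition clifford_relations :: "'g set \<Rightarrow> ('g \<Rightarrow> 'k::field) \<Rightarrow> ('g fword \<Rightarrow>\<^sub>0 'k) set" where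
  "clifford_relations B Q =
     {Poly_Mapping.single (FWord [v, v]) 1 - Poly_Mapping.single 0 (Q v) | v. v \<in> B} \<union>
     {Poly_Mapping.single (FWord [v, w]) 1 + Poly_Mapping.single (FWord [w, v]) 1 | v w.
        v \<in> B \<and> w \<in> B \<and> v \<noteq> w}"

definition clifford_ideal :: "'g set \<Rightarrow> ('g \<Rightarrow> 'k::field) \<Rightarrow> ('g fword \<Rightarrow>\<^sub>0 'k) set" where
  "clifford_ideal B Q = genideal (free_alg B) (clifford_relations B Q)"

text \<open>The Clifford algebra of a quadratic form \<open>Q\<close>, presented with the vectors of an orthogonal
  basis \<open>B\<close> as generators.\<close>

definition clifford :: "'g set \<Rightarrow> ('g \<Rightarrow> 'k::field) \<Rightarrow> ('k, ('g fword \<Rightarrow>\<^sub>0 'k) set) module" where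
  "clifford B Q =
     (let F = free_alg B; I = clifford_ideal B Q; R = F Quot I in
      \<lparr>carrier = carrier R, mult = mult R, one = one R, zero = zero R, add = add R,
       smult = (\<lambda>c X. \<Union>p\<in>X. I +>\<^bsub>F\<^esub> (c \<odot>\<^bsub>F\<^esub> p))\<rparr>)"

definition clifford_gen :: "'g set \<Rightarrow> ('g \<Rightarrow> 'k::field) \<Rightarrow> 'g \<Rightarrow> ('g fword \<Rightarrow>\<^sub>0 'k) set" where
  "clifford_gen B Q v = clifford_ideal B Q +>\<^bsub>free_alg B\<^esub> Poly_Mapping.single (FWord [v]) 1"


section \<open>The monomials \<open>e\<^sub>x\<close>\<close>

definition Z2n :: "nat \<Rightarrow> (nat \<Rightarrow> nat) set" where
  "Z2n n = {..<n} \<rightarrow>\<^sub>E {0, 1}"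

definition Z2n_add :: "nat \<Rightarrow> (nat \<Rightarrow> nat) \<Rightarrow> (nat \<Rightarrow> nat) \<Rightarrow> nat \<Rightarrow> nat" where
  "Z2n_add n x y = (\<lambda>i\<in>{..<n}. (x i + y i) mod 2)"

definition rho :: "nat \<Rightarrow> (nat \<Rightarrow> nat) \<Rightarrow> nat" where
  "rho n x = (\<Sum>i<n. x i)"

definition dot :: "nat \<Rightarrow> (nat \<Rightarrow> nat) \<Rightarrow> (nat \<Rightarrow> nat) \<Rightarrow> nat" where
  "dot n x y = (\<Sum>i<n. x i * y i)"

definition twist :: "nat \<Rightarrow> (nat \<Rightarrow> 'k::field) \<Rightarrow> (nat \<Rightarrow> nat) \<Rightarrow> (nat \<Rightarrow> nat) \<Rightarrow> 'k" where
  "twist n q x y = (-1) ^ (\<Sum>i<n. \<Sum>j<i. x i * y j) * (\<Prod>i<n. q i ^ (x i * y i))"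

definition clifford_mono ::
    "nat \<Rightarrow> (nat \<Rightarrow> 'g) \<Rightarrow> ('g \<Rightarrow> 'k::field) \<Rightarrow> (nat \<Rightarrow> nat) \<Rightarrow> ('g fword \<Rightarrow>\<^sub>0 'k) set" where
  "clifford_mono n e Q x =
     (let C = clifford (e ` {..<n}) Q in
      foldr (\<lambda>i a. (clifford_gen (e ` {..<n}) Q (e i) [^]\<^bsub>C\<^esub> x i) \<otimes>\<^bsub>C\<^esub> a) [0..<n] \<one>\<^bsub>C\<^esub>)"

text \<open>The homogeneous component of degree \<open>d\<close> in \<open>{0, 1}\<close>: the span of the \<open>e\<^sub>x\<close> with
  \<open>\<rho>(x) \<equiv> d\<close> modulo 2.\<close>

definition clifford_part ::
    "nat \<Rightarrow> (nat \<Rightarrow> 'g) \<Rightarrow> ('g \<Rightarrow> 'k::field) \<Rightarrow> nat \<Rightarrow> ('g fword \<Rightarrow>\<^sub>0 'k) set set" where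
  "clifford_part n e Q d =
     (let C = clifford (e ` {..<n}) Q in
      {finsum C (\<lambda>x. c x \<odot>\<^bsub>C\<^esub> clifford_mono n e Q x) {x \<in> Z2n n. rho n x mod 2 = d} | c. True})"


section \<open>The super tensor product\<close>

text \<open>The underlying space is the usual quotient of the space with basis
  \<open>carrier A \<times> carrier B\<close> by the subspace of bilinearity relations.\<close>

definition pm_scale :: "'k::field \<Rightarrow> ('s \<Rightarrow>\<^sub>0 'k) \<Rightarrow> 's \<Rightarrow>\<^sub>0 'k" where
  "pm_scale c u = Poly_Mapping.map ((*) c) u"

definition tensor_relations ::
    "('k::field, 'a, 'm) module_scheme \<Rightarrow> ('k, 'b, 'l) module_scheme \<Rightarrow> ('a \<times> 'b \<Rightarrow>\<^sub>0 'k) set" where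
  "tensor_relations A B =
     {Poly_Mapping.single (a \<oplus>\<^bsub>A\<^esub> a', b) 1 - Poly_Mapping.single (a, b) 1
        - Poly_Mapping.single (a', b) 1 | a a' b. a \<in> carrier A \<and> a' \<in> carrier A \<and> b \<in> carrier B} \<union>
     {Poly_Mapping.single (a, b \<oplus>\<^bsub>B\<^esub> b') 1 - Poly_Mapping.single (a, b) 1
        - Poly_Mapping.single (a, b') 1 | a b b'. a \<in> carrier A \<and> b \<in> carrier B \<and> b' \<in> carrier B} \<union>
     {Poly_Mapping.single (c \<odot>\<^bsub>A\<^esub> a, b) 1 - Poly_Mapping.single (a, b) c
        | c a b. a \<in> carrier A \<and> b \<in> carrier B} \<union>
     {Poly_Mapping.single (a, c \<odot>\<^bsub>B\<^esub> b) 1 - Poly_Mapping.single (a, b) c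
        | c a b. a \<in> carrier A \<and> b \<in> carrier B}"

definition tensor_class ::
    "('k::field, 'a, 'm) module_scheme \<Rightarrow> ('k, 'b, 'l) module_scheme \<Rightarrow>
     ('a \<times> 'b \<Rightarrow>\<^sub>0 'k) \<Rightarrow> ('a \<times> 'b \<Rightarrow>\<^sub>0 'k) set" where
  "tensor_class A B u = {u + r | r. r \<in> module.span pm_scale (tensor_relations A B)}"

definition tensor ::
    "('k::field, 'a, 'm) module_scheme \<Rightarrow> ('k, 'b, 'l) module_scheme \<Rightarrow>
     'a \<Rightarrow> 'b \<Rightarrow> ('a \<times> 'b \<Rightarrow>\<^sub>0 'k) set" where
  "tensor A B a b = tensor_class A B (Poly_Mapping.single (a, b) 1)"

text \<open>A \<open>\<int>\<^sub>2\<close>-grading of an algebra is given by its components \<open>G 0\<close> (even) and \<open>G 1\<close> (odd).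
  \<open>hom_part A G d\<close> is the projection to the component of degree \<open>d\<close> in \<open>{0, 1}\<close>.\<close>

definition hom_part ::
    "('k::field, 'a, 'm) module_scheme \<Rightarrow> (nat \<Rightarrow> 'a set) \<Rightarrow> nat \<Rightarrow> 'a \<Rightarrow> 'a" where
  "hom_part A G d a = (THE a'. a' \<in> G d \<and> (\<exists>a''\<in>G (1 - d). a = a' \<oplus>\<^bsub>A\<^esub> a''))"

text \<open>The bilinear extension of the rule
  \<open>(a \<otimes> c) (b \<otimes> d) = (-1) ^ (deg c * deg b) (ab \<otimes> cd)\<close> for homogeneous \<open>b\<close> and \<open>c\<close>; the inner
  sum decomposes \<open>b\<close> and \<open>c\<close> into their components of degree \<open>j\<close> and \<open>i\<close>.\<close>

definition super_mult_free ::
    "('k::field, 'a, 'm) module_scheme \<Rightarrow> (nat \<Rightarrow> 'a set) \<Rightarrow>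
     ('k, 'b, 'l) module_scheme \<Rightarrow> (nat \<Rightarrow> 'b set) \<Rightarrow>
     ('a \<times> 'b \<Rightarrow>\<^sub>0 'k) \<Rightarrow> ('a \<times> 'b \<Rightarrow>\<^sub>0 'k) \<Rightarrow> ('a \<times> 'b \<Rightarrow>\<^sub>0 'k)" where
  "super_mult_free A G B H u v =
     (\<Sum>(a, c)\<in>Poly_Mapping.keys u. \<Sum>(b, d)\<in>Poly_Mapping.keys v. \<Sum>i\<in>{0, 1}. \<Sum>j\<in>{0, 1}.
        Poly_Mapping.single (a \<otimes>\<^bsub>A\<^esub> hom_part A G j b, hom_part B H i c \<otimes>\<^bsub>B\<^esub> d)
          ((-1) ^ (i * j) * Poly_Mapping.lookup u (a, c) * Poly_Mapping.lookup v (b, d)))"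

definition super_tensor ::
    "('k::field, 'a, 'm) module_scheme \<Rightarrow> (nat \<Rightarrow> 'a set) \<Rightarrow>
     ('k, 'b, 'l) module_scheme \<Rightarrow> (nat \<Rightarrow> 'b set) \<Rightarrow>
     ('k, ('a \<times> 'b \<Rightarrow>\<^sub>0 'k) set) module" where
  "super_tensor A G B H =
     \<lparr>carrier = tensor_class A B ` {u. Poly_Mapping.keys u \<subseteq> carrier A \<times> carrier B},
      mult = (\<lambda>X Y. \<Union>u\<in>X. \<Union>v\<in>Y. tensor_class A B (super_mult_free A G B H u v)),
      one = tensor A B \<one>\<^bsub>A\<^esub> \<one>\<^bsub>B\<^esub>,
      zero = tensor_class A B 0,
      add = (\<lambda>X Y. \<Union>u\<in>X. \<Union>v\<in>Y. tensor_class A B (u + v)),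
      smult = (\<lambda>c X. \<Union>u\<in>X. tensor_class A B (pm_scale c u))\<rparr>"

end

theory Submission
  imports Defs
begin

text \<open>Sending a word in the generators to its normal form \<open>\<plusminus> (\<Prod> q\<^sub>i) e\<^sub>x\<close> is multiplicative because
  the twist \<open>F\<close> is a 2-cocycle on \<open>\<int>\<^sub>2\<^sup>n\<close>; the kernel of the resulting map on the free algebra
  is exactly the Clifford ideal, so \<open>C(V, q)\<close> is the twisted group algebra of \<open>\<int>\<^sub>2\<^sup>n\<close>.
  The same argument for the \<open>2n\<close> generators of \<open>C(V \<oplus> V, q \<oplus> q)\<close>, and a direct computation of the
  kernel for the super tensor product, identify both algebras with the twisted group algebra of
  \<open>\<int>\<^sub>2\<^bsup>2n\<^esup>\<close>.  In the basis \<open>e\<^sub>z\<close>, the entries \<open>e\<^sub>z \<mapsto> e\<^bsub>u+z\<^esub>\<close> of the operator of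
  \<open>\<Sum> t\<^bsub>x,y\<^esub> e\<^sub>x \<otimes> e\<^sub>y\<close> form, up to nonzero factors, the Fourier transform on \<open>\<int>\<^sub>2\<^sup>n\<close> of
  \<open>y \<mapsto> t\<^bsub>u+y,y\<^esub>\<close>.  Since \<open>2\<close> is invertible, every matrix arises from exactly one \<open>t\<close>; this
  gives the isomorphism with the endomorphism algebra, and irreducibility follows from
  surjectivity.\<close>

section \<open>Index arithmetic and the twist\<close>

text \<open>Origin of the factors \<open>(-1) ^ dot n y z\<close> and
  \<open>\<iota> ^ rho n y\<close>: by the super sign rule, \<open>1 \<otimes> e_i\<close> has to
  anticommute with every \<open>e_j \<otimes> 1\<close>, including \<open>j = i\<close>. Left
  multiplication by \<open>e_i\<close> anticommutes with left multiplication by \<open>e_j\<close>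
  for \<open>j \<noteq> i\<close>, but commutes with itself. The operator multiplying
  \<open>e_z\<close> by \<open>(-1) ^ z i\<close> anticommutes with left multiplication by
  \<open>e_i\<close> and commutes with the others, so composing with it repairs the case
  \<open>j = i\<close>. The composite has square \<open>- q i\<close>, and the factor
  \<open>\<iota>\<close> restores \<open>q i\<close>. The obstacle is that both algebras are
  quotients by relations, in which the independence of the basis elements is not visible. Both are
  treated alike: a linear map from representatives to coordinate functions is shown to have exactly
  the relations as kernel. Classes then are fibres of this map, and an operation on classes can be
  computed on the coordinates of any representatives.\<close>

definition ix_zero :: "nat \<Rightarrow> nat \<Rightarrow> nat" where
  "ix_zero n = (\<lambda>i\<in>{..<n}. 0)"

definition ix_unit :: "nat \<Rightarrow> nat \<Rightarrow> nat \<Rightarrow> nat" where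
  "ix_unit n i = (\<lambda>j\<in>{..<n}. if j = i then 1 else 0)"

lemma Z2n_mem: "x \<in> Z2n n \<Longrightarrow> i < n \<Longrightarrow> x i = 0 \<or> x i = 1"
  by (auto simp: Z2n_def PiE_def Pi_def)

lemma Z2n_eqI:
  assumes "x \<in> Z2n n" "y \<in> Z2n n" "\<And>i. i < n \<Longrightarrow> x i = y i"
  shows "x = y"
  using assms unfolding Z2n_def by (intro PiE_ext) auto

lemma finite_Z2n [simp]: "finite (Z2n n)"
  by (simp add: Z2n_def finite_PiE)

lemma restrict_in_Z2n: "(\<And>i. i < n \<Longrightarrow> f i = 0 \<or> f i = 1) \<Longrightarrow> restrict f {..<n} \<in> Z2n n"
  unfolding Z2n_def restrict_PiE_iff by blast

lemma ix_zero_closed [simp]: "ix_zero n \<in> Z2n n"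
  unfolding ix_zero_def by (rule restrict_in_Z2n) simp

lemma ix_unit_closed [simp]: "ix_unit n i \<in> Z2n n"
  unfolding ix_unit_def by (rule restrict_in_Z2n) simp

lemma Z2n_add_closed [simp]: "Z2n_add n x y \<in> Z2n n"
  unfolding Z2n_add_def by (rule restrict_in_Z2n) auto

lemma ix_apply [simp]:
  "i < n \<Longrightarrow> ix_zero n i = 0"
  "i < n \<Longrightarrow> ix_unit n j i = (if i = j then 1 else 0)"
  "i < n \<Longrightarrow> Z2n_add n x y i = (x i + y i) mod 2"
  by (auto simp: ix_zero_def ix_unit_def Z2n_add_def)

lemma Z2n_add_commute: "Z2n_add n x y = Z2n_add n y x"
  by (simp add: Z2n_add_def add.commute)

lemma Z2n_add_assoc: "Z2n_add n (Z2n_add n x y) z = Z2n_add n x (Z2n_add n y z)"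
  by (rule Z2n_eqI[of _ n]) (auto simp: mod_simps add.assoc)

lemma Z2n_add_left_commute: "Z2n_add n x (Z2n_add n y z) = Z2n_add n y (Z2n_add n x z)"
  by (metis Z2n_add_assoc Z2n_add_commute)

lemmas Z2n_add_ac = Z2n_add_assoc Z2n_add_commute Z2n_add_left_commute

lemma Z2n_add_zero [simp]:
  assumes "x \<in> Z2n n"
  shows "Z2n_add n (ix_zero n) x = x" "Z2n_add n x (ix_zero n) = x"
proof -
  show "Z2n_add n (ix_zero n) x = x"
    using assms Z2n_mem[OF assms] by (intro Z2n_eqI[of _ n]) (auto, fastforce)
  then show "Z2n_add n x (ix_zero n) = x" by (simp add: Z2n_add_commute)
qed

lemma Z2n_add_self [simp]: "Z2n_add n x x = ix_zero n"
  by (rule Z2n_eqI[of _ n]) auto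

lemma Z2n_add_cancel [simp]:
  assumes "x \<in> Z2n n"
  shows "Z2n_add n y (Z2n_add n y x) = x"
  using assms by (simp flip: Z2n_add_assoc)

lemma Z2n_add_eq_iff:
  assumes "y \<in> Z2n n" "z \<in> Z2n n"
  shows "Z2n_add n x y = z \<longleftrightarrow> y = Z2n_add n x z"
  using assms Z2n_add_cancel by metis

lemma bij_betw_Z2n_add: "bij_betw (Z2n_add n x) (Z2n n) (Z2n n)"
  by (rule bij_betwI[where g = "Z2n_add n x"]) auto

lemma sum_Z2n_translate: "(\<Sum>y\<in>Z2n n. f (Z2n_add n x y)) = (\<Sum>y\<in>Z2n n. f y)"
  by (rule sum.reindex_bij_betw[OF bij_betw_Z2n_add])

lemma minus_one_power_cong:
  "even a = even b \<Longrightarrow> (-1 :: 'a::ring_1) ^ a = (-1) ^ b"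
  by (simp add: minus_one_power_iff)

text \<open>As a single product over \<open>i\<close>, identities between twists can be checked one
  index at a time.\<close>

lemma twist_prod:
  "twist n q x y = (\<Prod>i<n. (\<Prod>j<i. (-1) ^ (x i * y j)) * q i ^ (x i * y i))"
  by (simp add: twist_def power_sum prod.distrib)

lemma twist_nonzero: "(\<And>i. i < n \<Longrightarrow> q i \<noteq> 0) \<Longrightarrow> twist n q x y \<noteq> 0"
  by (simp add: twist_def)

lemma twist_zero [simp]: "twist n q (ix_zero n) x = 1" "twist n q x (ix_zero n) = 1"
  by (simp_all add: twist_prod)

text \<open>Associativity of \<open>e\<^sub>x e\<^sub>y e\<^sub>z\<close>.\<close>

lemma twist_cocycle:
  assumes "x \<in> Z2n n" "y \<in> Z2n n" "z \<in> Z2n n"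
  shows "twist n q x y * twist n q (Z2n_add n x y) z =
         twist n q y z * twist n q x (Z2n_add n y z)"
proof -
  have "(\<Prod>j<i. (-1) ^ (x i * y j)) * q i ^ (x i * y i) *
        ((\<Prod>j<i. (-1) ^ (Z2n_add n x y i * z j)) * q i ^ (Z2n_add n x y i * z i)) =
        (\<Prod>j<i. (-1) ^ (y i * z j)) * q i ^ (y i * z i) *
        ((\<Prod>j<i. (-1) ^ (x i * Z2n_add n y z j)) * q i ^ (x i * Z2n_add n y z i))"
    (is "?X * ?A * (?Y * ?B) = ?Z * ?C * (?W * ?D)") if "i < n" for i
  proof -
    have "(- 1) ^ (x i * y j) * (- 1) ^ (Z2n_add n x y i * z j) =
          (- 1) ^ (y i * z j) * (- 1 :: 'a) ^ (x i * Z2n_add n y z j)" if "j < i" for j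
      using that \<open>i < n\<close> by (auto simp flip: power_add intro!: minus_one_power_cong)
    then have "?X * ?Y = ?Z * ?W" by (simp flip: prod.distrib)
    \<comment> \<open>Signs depend only on parities, but powers of \<open>q i\<close> need equal
      exponents; this uses that the components are bits.\<close>
    moreover have "?A * ?B = ?C * ?D"
      using Z2n_mem[OF assms(1) that] Z2n_mem[OF assms(2) that] Z2n_mem[OF assms(3) that] that
      by (auto simp: numeral_2_eq_2)
    ultimately have "(?X * ?Y) * (?A * ?B) = (?Z * ?W) * (?C * ?D)" by (rule arg_cong2)
    then show ?thesis by (simp only: mult_ac)
  qed
  then show ?thesis unfolding twist_prod prod.distrib[symmetric] by (intro prod.cong) auto
qed

text \<open>The index pairs are cut into those below, above and on the diagonal. The first two parts
  are the sign exponents of \<open>twist\<close> for the two orders of its arguments.\<close>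

lemma sum_mult_sum_split:
  fixes f g :: "nat \<Rightarrow> nat"
  shows "(\<Sum>i<n. f i) * (\<Sum>i<n. g i) =
         (\<Sum>i<n. \<Sum>j<i. f i * g j) + (\<Sum>i<n. \<Sum>j<i. g i * f j) + (\<Sum>i<n. f i * g i)"
  by (induction n) (simp_all add: algebra_simps sum_distrib_left)

text \<open>Of the \<open>rho n y * rho n x\<close> transpositions of generators, the
  \<open>dot n y x\<close> ones that exchange equal generators produce no sign.\<close>

lemma twist_commute:
  "twist n q y x = (-1) ^ (rho n y * rho n x + dot n y x) * twist n q x y"
proof -
  have parity: "even a = even ((r + d) + b)" if "r = a + b + d" for a b d r :: nat
    using that by auto
  have "even (\<Sum>i<n. \<Sum>j<i. y i * x j) =
        even ((rho n y * rho n x + dot n y x) + (\<Sum>i<n. \<Sum>j<i. x i * y j))"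
    unfolding rho_def dot_def by (rule parity[OF sum_mult_sum_split])
  then show ?thesis
    unfolding twist_def mult.assoc[symmetric] power_add[symmetric]
    by (simp add: minus_one_power_cong mult.commute)
qed

section \<open>Pairs of indices as indices of double length\<close>

definition ix_fst :: "nat \<Rightarrow> (nat \<Rightarrow> nat) \<Rightarrow> nat \<Rightarrow> nat" where
  "ix_fst n w = (\<lambda>i\<in>{..<n}. w i)"

definition ix_snd :: "nat \<Rightarrow> (nat \<Rightarrow> nat) \<Rightarrow> nat \<Rightarrow> nat" where
  "ix_snd n w = (\<lambda>i\<in>{..<n}. w (n + i))"

definition ix_pair :: "nat \<Rightarrow> (nat \<Rightarrow> nat) \<Rightarrow> (nat \<Rightarrow> nat) \<Rightarrow> nat \<Rightarrow> nat" where
  "ix_pair n x y = (\<lambda>i\<in>{..<n + n}. if i < n then x i else y (i - n))"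

text \<open>The values of the orthogonal sum form on its generators, the first copy of
  \<open>V\<close> listed before the second.\<close>

definition double :: "nat \<Rightarrow> (nat \<Rightarrow> 'a) \<Rightarrow> nat \<Rightarrow> 'a" where
  "double n q i = (if i < n then q i else q (i - n))"

lemma ix_fst_apply [simp]: "i < n \<Longrightarrow> ix_fst n w i = w i"
  and ix_snd_apply [simp]: "i < n \<Longrightarrow> ix_snd n w i = w (n + i)"
  by (simp_all add: ix_fst_def ix_snd_def)

lemma ix_fst_closed [simp]: "ix_fst n w \<in> Z2n n" if "w \<in> Z2n (n + n)"
  using Z2n_mem[OF that] unfolding ix_fst_def by (intro restrict_in_Z2n) auto

lemma ix_snd_closed [simp]: "ix_snd n w \<in> Z2n n" if "w \<in> Z2n (n + n)"
  using Z2n_mem[OF that] unfolding ix_snd_def by (intro restrict_in_Z2n) auto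

lemma ix_pair_closed [simp]: "x \<in> Z2n n \<Longrightarrow> y \<in> Z2n n \<Longrightarrow> ix_pair n x y \<in> Z2n (n + n)"
  unfolding ix_pair_def by (rule restrict_in_Z2n) (use Z2n_mem in auto)

lemma ix_fst_pair [simp]: "x \<in> Z2n n \<Longrightarrow> ix_fst n (ix_pair n x y) = x"
  and ix_snd_pair [simp]: "y \<in> Z2n n \<Longrightarrow> ix_snd n (ix_pair n x y) = y"
  by (auto simp: ix_fst_def ix_snd_def ix_pair_def Z2n_def fun_eq_iff PiE_def extensional_def)

lemma ix_pair_fst_snd [simp]:
  assumes "w \<in> Z2n (n + n)"
  shows "ix_pair n (ix_fst n w) (ix_snd n w) = w"
proof (rule Z2n_eqI[of _ "n + n"])
  show "ix_pair n (ix_fst n w) (ix_snd n w) \<in> Z2n (n + n)" using assms by simp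
qed (use assms in \<open>auto simp: ix_pair_def\<close>)

lemma ix_fst_add [simp]: "ix_fst n (Z2n_add (n + n) w w') = Z2n_add n (ix_fst n w) (ix_fst n w')"
  and ix_snd_add [simp]: "ix_snd n (Z2n_add (n + n) w w') = Z2n_add n (ix_snd n w) (ix_snd n w')"
  by (auto simp: ix_fst_def ix_snd_def Z2n_add_def fun_eq_iff)

lemma ix_fst_zero [simp]: "ix_fst n (ix_zero (n + n)) = ix_zero n"
  and ix_snd_zero [simp]: "ix_snd n (ix_zero (n + n)) = ix_zero n"
  by (auto simp: ix_fst_def ix_snd_def ix_zero_def fun_eq_iff)

lemma ix_unit_double:
  "i < n \<Longrightarrow> ix_unit (n + n) i = ix_pair n (ix_unit n i) (ix_zero n)"
  "i < n \<Longrightarrow> ix_unit (n + n) (n + i) = ix_pair n (ix_zero n) (ix_unit n i)"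
  by (auto simp: ix_unit_def ix_zero_def ix_pair_def fun_eq_iff)

lemma bij_betw_ix_fst_snd:
  "bij_betw (\<lambda>w. (ix_fst n w, ix_snd n w)) (Z2n (n + n)) (Z2n n \<times> Z2n n)"
  by (rule bij_betwI[where g = "\<lambda>(x, y). ix_pair n x y"]) auto

lemma sum_Z2n_double:
  "(\<Sum>w\<in>Z2n (n + n). f (ix_fst n w) (ix_snd n w)) = (\<Sum>x\<in>Z2n n. \<Sum>y\<in>Z2n n. f x y)"
  using sum.reindex_bij_betw[OF bij_betw_ix_fst_snd, of "\<lambda>(x, y). f x y" n]
  by (simp add: sum.cartesian_product)

lemma sum_lessThan_add: "(\<Sum>i<m + n. f i) = (\<Sum>i<m. f i) + (\<Sum>i<n. f (m + i))"
  for f :: "nat \<Rightarrow> 'a::comm_monoid_add"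
  by (induction n) (simp_all add: add.assoc)

lemma prod_lessThan_add: "(\<Prod>i<m + n. f i) = (\<Prod>i<m. f i) * (\<Prod>i<n. f (m + i))"
  for f :: "nat \<Rightarrow> 'a::comm_monoid_mult"
  by (induction n) (simp_all add: mult.assoc)

text \<open>The first factor is the sign rule of the super tensor product.\<close>

lemma twist_double:
  "twist (n + n) (double n q) w w' =
     (-1) ^ (rho n (ix_snd n w) * rho n (ix_fst n w')) *
     twist n q (ix_fst n w) (ix_fst n w') * twist n q (ix_snd n w) (ix_snd n w')"
proof -
  \<comment> \<open>Every index of the second half exceeds every index of the first, so the mixed
    pairs contribute the full product \<open>rho * rho\<close> in one order and nothing in the
    other.\<close>
  have "(\<Sum>i<n + n. \<Sum>j<i. w i * w' j) =
     rho n (ix_snd n w) * rho n (ix_fst n w') +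
     (\<Sum>i<n. \<Sum>j<i. ix_fst n w i * ix_fst n w' j) + (\<Sum>i<n. \<Sum>j<i. ix_snd n w i * ix_snd n w' j)"
    by (simp add: sum_lessThan_add sum.distrib rho_def sum_product)
  moreover have "(\<Prod>i<n + n. double n q i ^ (w i * w' i)) =
     (\<Prod>i<n. q i ^ (ix_fst n w i * ix_fst n w' i)) * (\<Prod>i<n. q i ^ (ix_snd n w i * ix_snd n w' i))"
    by (simp add: prod_lessThan_add double_def)
  ultimately show ?thesis by (simp add: twist_def power_add)
qed

section \<open>Twisted convolution\<close>

text \<open>Elements \<open>\<Sum> a\<^sub>x e\<^sub>x\<close> of a Clifford algebra are represented by their coordinates \<open>a\<close>.\<close>

definition coords :: "nat \<Rightarrow> ((nat \<Rightarrow> nat) \<Rightarrow> 'k::field) set" where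
  "coords n = {a. \<forall>x. x \<notin> Z2n n \<longrightarrow> a x = 0}"

definition delta :: "(nat \<Rightarrow> nat) \<Rightarrow> (nat \<Rightarrow> nat) \<Rightarrow> 'k::field" where
  "delta x = (\<lambda>y. if y = x then 1 else 0)"

text \<open>Each element of the index group is its own negative, so the partner of \<open>y\<close>
  in a pair with sum \<open>x\<close> is \<open>y + x\<close>. The value 0 elsewhere keeps results
  in \<open>coords n\<close>.\<close>

definition conv ::
    "nat \<Rightarrow> (nat \<Rightarrow> 'k::field) \<Rightarrow> ((nat \<Rightarrow> nat) \<Rightarrow> 'k) \<Rightarrow> ((nat \<Rightarrow> nat) \<Rightarrow> 'k) \<Rightarrow> (nat \<Rightarrow> nat) \<Rightarrow> 'k"
  where "conv n q a b = (\<lambda>x. if x \<in> Z2n n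
    then \<Sum>y\<in>Z2n n. twist n q y (Z2n_add n y x) * a y * b (Z2n_add n y x) else 0)"

definition coord_alg :: "nat \<Rightarrow> (nat \<Rightarrow> 'k::field) \<Rightarrow> ('k, (nat \<Rightarrow> nat) \<Rightarrow> 'k) module" where
  "coord_alg n q = \<lparr>carrier = coords n, mult = conv n q, one = delta (ix_zero n), zero = (\<lambda>x. 0),
     add = (\<lambda>a b x. a x + b x), smult = (\<lambda>c a x. c * a x)\<rparr>"

lemma coord_alg_simps [simp]:
  "carrier (coord_alg n q) = coords n" "mult (coord_alg n q) = conv n q"
  "one (coord_alg n q) = delta (ix_zero n)" "zero (coord_alg n q) = (\<lambda>x. 0)"
  "add (coord_alg n q) = (\<lambda>a b x. a x + b x)" "smult (coord_alg n q) = (\<lambda>c a x. c * a x)"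
  by (simp_all add: coord_alg_def)

lemma coords_closed [simp]:
  "(\<lambda>x. 0) \<in> coords n"
  "a \<in> coords n \<Longrightarrow> b \<in> coords n \<Longrightarrow> (\<lambda>x. a x + b x) \<in> coords n"
  "a \<in> coords n \<Longrightarrow> (\<lambda>x. c * a x) \<in> coords n"
  "x \<in> Z2n n \<Longrightarrow> delta x \<in> coords n"
  "conv n q a b \<in> coords n"
  by (auto simp: coords_def delta_def conv_def)

lemma coords_sum [simp]:
  "(\<And>i. i \<in> A \<Longrightarrow> f i \<in> coords n) \<Longrightarrow> (\<lambda>x. \<Sum>i\<in>A. f i x) \<in> coords n"
  by (auto simp: coords_def intro!: sum.neutral)

lemma coords_expand:
  assumes "a \<in> coords n"
  shows "a = (\<lambda>y. \<Sum>x\<in>Z2n n. a x * delta x y)"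
  using assms by (auto simp: coords_def delta_def if_distrib cong: if_cong)

lemma conv_delta:
  assumes "x \<in> Z2n n" "y \<in> Z2n n"
  shows "conv n q (delta x) (delta y) = (\<lambda>z. twist n q x y * delta (Z2n_add n x y) z)"
proof
  fix z
  have "conv n q (delta x) (delta y) z =
    (if z \<in> Z2n n then twist n q x (Z2n_add n x z) * delta y (Z2n_add n x z) else 0)"
  proof -
    have "(\<Sum>u\<in>Z2n n. twist n q u (Z2n_add n u z) * delta x u * delta y (Z2n_add n u z)) =
      (\<Sum>u\<in>Z2n n. if u = x then twist n q x (Z2n_add n x z) * delta y (Z2n_add n x z) else 0)"
      by (rule sum.cong) (auto simp: delta_def)
    then show ?thesis using assms by (simp add: conv_def)
  qed
  also have "\<dots> = twist n q x y * delta (Z2n_add n x y) z"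
    using assms by (auto simp: delta_def)
  finally show "conv n q (delta x) (delta y) z = twist n q x y * delta (Z2n_add n x y) z" .
qed

text \<open>Stated for weighted sums, so that one rewrite pulls out a whole basis expansion; scaling
  is the case of a single summand.\<close>

lemma conv_sum_left:
  "conv n q (\<lambda>x. \<Sum>i\<in>A. c i * f i x) b = (\<lambda>x. \<Sum>i\<in>A. c i * conv n q (f i) b x)"
proof
  fix x
  have "(\<Sum>y\<in>Z2n n. twist n q y (Z2n_add n y x) * (\<Sum>i\<in>A. c i * f i y) * b (Z2n_add n y x)) =
    (\<Sum>y\<in>Z2n n. \<Sum>i\<in>A. c i * (twist n q y (Z2n_add n y x) * f i y * b (Z2n_add n y x)))"
    unfolding sum_distrib_left sum_distrib_right by (intro sum.cong refl) (simp add: mult_ac)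
  then show "conv n q (\<lambda>x. \<Sum>i\<in>A. c i * f i x) b x = (\<Sum>i\<in>A. c i * conv n q (f i) b x)"
    unfolding conv_def by (subst (asm) sum.swap) (simp add: sum_distrib_left)
qed

lemma conv_sum_right:
  "conv n q a (\<lambda>x. \<Sum>i\<in>A. c i * f i x) = (\<lambda>x. \<Sum>i\<in>A. c i * conv n q a (f i) x)"
proof
  fix x
  have "(\<Sum>y\<in>Z2n n. twist n q y (Z2n_add n y x) * a y * (\<Sum>i\<in>A. c i * f i (Z2n_add n y x))) =
    (\<Sum>y\<in>Z2n n. \<Sum>i\<in>A. c i * (twist n q y (Z2n_add n y x) * a y * f i (Z2n_add n y x)))"
    unfolding sum_distrib_left by (intro sum.cong refl) (simp add: mult_ac)
  then show "conv n q a (\<lambda>x. \<Sum>i\<in>A. c i * f i x) x = (\<Sum>i\<in>A. c i * conv n q a (f i) x)"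
    unfolding conv_def by (subst (asm) sum.swap) (simp add: sum_distrib_left)
qed

lemma conv_scale_left: "conv n q (\<lambda>x. c * a x) b = (\<lambda>x. c * conv n q a b x)"
  using conv_sum_left[where A = "{()}" and c = "\<lambda>_. c" and f = "\<lambda>_. a"] by simp

lemma conv_scale_right: "conv n q a (\<lambda>x. c * b x) = (\<lambda>x. c * conv n q a b x)"
  using conv_sum_right[where A = "{()}" and c = "\<lambda>_. c" and f = "\<lambda>_. b"] by simp

lemma conv_zero [simp]: "conv n q a (\<lambda>x. 0) = (\<lambda>x. 0)" "conv n q (\<lambda>x. 0) a = (\<lambda>x. 0)"
  by (auto simp: conv_def)

section \<open>Linear extension on finitely supported functions\<close>

text \<open>Linear extension with values in coordinate functions; it serves both for words in the
  generators and for formal pairs in the tensor product.\<close>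

definition lin :: "('s \<Rightarrow> 'x \<Rightarrow> 'k::field) \<Rightarrow> ('s \<Rightarrow>\<^sub>0 'k) \<Rightarrow> 'x \<Rightarrow> 'k" where
  "lin K p x = (\<Sum>s\<in>Poly_Mapping.keys p. Poly_Mapping.lookup p s * K s x)"

lemma lin_superset:
  assumes "finite A" "Poly_Mapping.keys p \<subseteq> A"
  shows "lin K p x = (\<Sum>s\<in>A. Poly_Mapping.lookup p s * K s x)"
  unfolding lin_def using assms by (intro sum.mono_neutral_left) (auto simp: in_keys_iff)

lemma lin_zero [simp]: "lin K 0 x = 0"
  by (simp add: lin_def)

lemma lin_add: "lin K (p + p') x = lin K p x + lin K p' x"
proof -
  let ?A = "Poly_Mapping.keys p \<union> Poly_Mapping.keys p'"
  have "lin K r x = (\<Sum>s\<in>?A. Poly_Mapping.lookup r s * K s x)" if "r \<in> {p, p', p + p'}" for r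
    using that keys_add[of p p'] by (intro lin_superset) auto
  then show ?thesis by (simp add: lookup_add distrib_right sum.distrib)
qed

lemma lin_diff: "lin K (p - p') x = lin K p x - lin K p' x"
  using lin_add[of K "p - p'" p' x] by simp

lemma lin_single [simp]: "lin K (Poly_Mapping.single s c) x = c * K s x"
  by (cases "c = 0") (auto simp: lin_def)

lemma lin_sum: "lin K (\<Sum>i\<in>A. f i) x = (\<Sum>i\<in>A. lin K (f i) x)"
  by (induction A rule: infinite_finite_induct) (simp_all add: lin_add)

lemma lookup_pm_scale [simp]: "Poly_Mapping.lookup (pm_scale c p) s = c * Poly_Mapping.lookup p s"
  by (auto simp: pm_scale_def map.rep_eq when_def)

lemma keys_pm_scale: "Poly_Mapping.keys (pm_scale c p) \<subseteq> Poly_Mapping.keys p"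
  by (auto simp: in_keys_iff)

lemma lin_scale: "lin K (pm_scale c p) x = c * lin K p x"
  by (subst lin_superset[OF _ keys_pm_scale]) (simp_all add: lin_def sum_distrib_left mult.assoc)

lemma pm_expand: "p = (\<Sum>s\<in>Poly_Mapping.keys p. Poly_Mapping.single s (Poly_Mapping.lookup p s))"
  by (rule poly_mapping_eqI) (auto simp: lookup_sum lookup_single when_def in_keys_iff)

lemma single_sum: "Poly_Mapping.single s (\<Sum>i\<in>A. f i) = (\<Sum>i\<in>A. Poly_Mapping.single s (f i))"
  by (induction A rule: infinite_finite_induct) (simp_all add: single_add)

lemma pm_mult_expand:
  "p * p' = (\<Sum>s\<in>Poly_Mapping.keys p. \<Sum>t\<in>Poly_Mapping.keys p'.
     Poly_Mapping.single (s + t) (Poly_Mapping.lookup p s * Poly_Mapping.lookup p' t))"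
  for p p' :: "'s::monoid_add \<Rightarrow>\<^sub>0 'k::field"
  by (subst pm_expand[of p], subst pm_expand[of p'])
    (simp add: sum_product mult_single)

text \<open>Operations on quotients are defined as unions over all representatives. Such a union is
  a single class once all representatives give the same class and there is at least one.\<close>

lemma UN_const: "A \<noteq> {} \<Longrightarrow> (\<And>u. u \<in> A \<Longrightarrow> f u = c) \<Longrightarrow> (\<Union>u\<in>A. f u) = c"
  by auto

section \<open>The Clifford ideal\<close>

lemma free_alg_simps [simp]:
  "mult (free_alg B) = (*)" "one (free_alg B) = 1" "zero (free_alg B) = 0"
  "add (free_alg B) = (+)" "smult (free_alg B) = pm_scale"
  by (simp_all add: free_alg_def pm_scale_def fun_eq_iff)

lemma carrier_free_alg:
  "p \<in> carrier (free_alg B) \<longleftrightarrow> (\<forall>w\<in>Poly_Mapping.keys p. set (letters w) \<subseteq> B)"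
  by (simp add: free_alg_def)

lemma free_alg_closed:
  "0 \<in> carrier (free_alg B)" "1 \<in> carrier (free_alg B)"
  "p \<in> carrier (free_alg B) \<Longrightarrow> p' \<in> carrier (free_alg B) \<Longrightarrow> p + p' \<in> carrier (free_alg B)"
  "p \<in> carrier (free_alg B) \<Longrightarrow> p' \<in> carrier (free_alg B) \<Longrightarrow> p - p' \<in> carrier (free_alg B)"
  "p \<in> carrier (free_alg B) \<Longrightarrow> p' \<in> carrier (free_alg B) \<Longrightarrow> p * p' \<in> carrier (free_alg B)"
  "p \<in> carrier (free_alg B) \<Longrightarrow> pm_scale c p \<in> carrier (free_alg B)"
  "p \<in> carrier (free_alg B) \<Longrightarrow> - p \<in> carrier (free_alg B)"
  "set w \<subseteq> B \<Longrightarrow> Poly_Mapping.single (FWord w) c \<in> carrier (free_alg B)"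
  "Poly_Mapping.single 0 c \<in> carrier (free_alg B)"
  using keys_add[of p p'] keys_diff[of p p'] keys_mult[of p p'] keys_pm_scale[of c p]
  unfolding carrier_free_alg
  by (fastforce simp: zero_fword_def plus_fword_def simp flip: single_one split: if_splits)+

lemma free_alg_sum:
  "(\<And>i. i \<in> A \<Longrightarrow> f i \<in> carrier (free_alg B)) \<Longrightarrow> (\<Sum>i\<in>A. f i) \<in> carrier (free_alg B)"
  by (induction A rule: infinite_finite_induct) (auto intro: free_alg_closed)

lemma ring_free_alg: "ring (free_alg B)"
proof (rule ringI)
  show "abelian_group (free_alg B)"
    by (rule abelian_groupI)
      (auto intro: free_alg_closed simp: add_ac intro!: bexI[of _ "- x" for x])
  show "monoid (free_alg B)"
    by (rule monoidI) (auto intro: free_alg_closed simp: mult.assoc)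
qed (auto simp: distrib_left distrib_right)

text \<open>Instantiated twice in the end: by the basis of \<open>V\<close>, and by the generators
  of \<open>V \<oplus> V\<close>.\<close>

locale clifford_gens =
  fixes n :: nat and \<epsilon> :: "nat \<Rightarrow> 'g" and Q :: "'g \<Rightarrow> 'k::field"
  assumes inj: "inj_on \<epsilon> {..<n}"
begin

abbreviation "B \<equiv> \<epsilon> ` {..<n}"
abbreviation "q \<equiv> (\<lambda>i. Q (\<epsilon> i))"
abbreviation "P \<equiv> (carrier (free_alg B) :: ('g fword \<Rightarrow>\<^sub>0 'k) set)"
abbreviation "I \<equiv> clifford_ideal B Q"
abbreviation "C \<equiv> clifford B Q"
abbreviation "index \<equiv> the_inv_into {..<n} \<epsilon>"
abbreviation "S c w \<equiv> Poly_Mapping.single (FWord w) (c :: 'k)"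

lemma index [simp]: "i < n \<Longrightarrow> index (\<epsilon> i) = i"
  using inj by (simp add: the_inv_into_f_f)

section \<open>Evaluation of words in the twisted group algebra\<close>

primrec word_ix :: "'g list \<Rightarrow> nat \<Rightarrow> nat" where
  "word_ix [] = ix_zero n"
| "word_ix (g # w) = Z2n_add n (ix_unit n (index g)) (word_ix w)"

text \<open>The letters of \<open>w\<close> multiply to \<open>word_scalar w\<close> times the basis
  element with index \<open>word_ix w\<close>, bracketed to the right.\<close>

primrec word_scalar :: "'g list \<Rightarrow> 'k" where
  "word_scalar [] = 1"
| "word_scalar (g # w) = twist n q (ix_unit n (index g)) (word_ix w) * word_scalar w"

lemma word_ix_closed [simp]: "word_ix w \<in> Z2n n"
  by (cases w) auto

lemma word_ix_append: "word_ix (u @ v) = Z2n_add n (word_ix u) (word_ix v)"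
  by (induction u) (simp_all add: Z2n_add_assoc)

text \<open>Multiplicativity on words. The cocycle identity for the first letter is the change of
  bracketing in the induction step.\<close>

lemma word_scalar_append:
  "word_scalar (u @ v) = word_scalar u * word_scalar v * twist n q (word_ix u) (word_ix v)"
proof (induction u)
  case (Cons g u)
  show ?case
    using twist_cocycle[of "ix_unit n (index g)" n "word_ix u" "word_ix v" q] Cons
    by (simp add: word_ix_append mult_ac)
qed simp

text \<open>The homomorphism from the free algebra to the twisted group algebra that evaluates
  words.\<close>

definition eta :: "('g fword \<Rightarrow>\<^sub>0 'k) \<Rightarrow> (nat \<Rightarrow> nat) \<Rightarrow> 'k" where
  "eta = lin (\<lambda>w x. word_scalar (letters w) * delta (word_ix (letters w)) x)"

lemma eta_closed [simp]: "eta p \<in> coords n"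
  unfolding eta_def lin_def by (intro coords_sum coords_closed) simp

lemma eta_linear [simp]:
  "eta 0 = (\<lambda>x. 0)" "eta (p + p') = (\<lambda>x. eta p x + eta p' x)"
  "eta (p - p') = (\<lambda>x. eta p x - eta p' x)" "eta (pm_scale c p) = (\<lambda>x. c * eta p x)"
  "eta (\<Sum>i\<in>A. f i) = (\<lambda>x. \<Sum>i\<in>A. eta (f i) x)"
  "eta (S c w) = (\<lambda>x. c * (word_scalar w * delta (word_ix w) x))"
  "eta (Poly_Mapping.single 0 c) = (\<lambda>x. c * delta (ix_zero n) x)"
  "eta 1 = delta (ix_zero n)"
  unfolding eta_def single_one[symmetric]
  by (simp_all add: lin_add lin_diff lin_scale lin_sum fun_eq_iff zero_fword_def del: single_one)

lemma eta_mult [simp]: "eta (p * p') = conv n q (eta p) (eta p')"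
proof -
  let ?K = "\<lambda>w x. word_scalar (letters w) * delta (word_ix (letters w)) x"
  have K: "conv n q (?K s) (?K t) = ?K (s + t)" for s t :: "'g fword"
  proof -
    show ?thesis
      by (simp add: conv_scale_left conv_scale_right conv_delta plus_fword_def
          word_ix_append word_scalar_append mult_ac)
  qed
  have "eta (p * p') = (\<lambda>x. \<Sum>s\<in>Poly_Mapping.keys p. \<Sum>t\<in>Poly_Mapping.keys p'.
      Poly_Mapping.lookup p s * Poly_Mapping.lookup p' t * ?K (s + t) x)"
    by (subst pm_mult_expand) (simp add: eta_def lin_sum fun_eq_iff)
  also have "\<dots> = conv n q (eta p) (eta p')"
    by (simp only: eta_def lin_def[abs_def] conv_sum_left conv_sum_right K sum_distrib_left mult.assoc)
  finally show ?thesis .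
qed

text \<open>Multiplied from the left, \<open>e_i\<close> passes the factors of smaller index and
  then meets its own copy, if there is one.\<close>

lemma twist_unit:
  assumes "i < n"
  shows "twist n q (ix_unit n i) x = (-1) ^ (\<Sum>j<i. x j) * q i ^ x i"
proof -
  have "(\<Sum>k<n. \<Sum>j<k. ix_unit n i k * x j) = (\<Sum>k<n. if k = i then \<Sum>j<i. x j else 0)"
    by (rule sum.cong) auto
  moreover have "(\<Prod>k<n. q k ^ (ix_unit n i k * x k)) = (\<Prod>k<n. if k = i then q i ^ x i else 1)"
    by (rule prod.cong) auto
  ultimately show ?thesis using assms by (simp add: twist_def)
qed

section \<open>Rewriting words modulo the Clifford ideal\<close>

lemma relations_closed: "clifford_relations B Q \<subseteq> P"
  by (auto simp: clifford_relations_def intro!: free_alg_closed)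

lemma ideal_I: "ideal I (free_alg B)"
  unfolding clifford_ideal_def by (rule ring.genideal_ideal[OF ring_free_alg relations_closed])

lemma I_closed:
  "0 \<in> I" "p \<in> I \<Longrightarrow> p' \<in> I \<Longrightarrow> p + p' \<in> I"
  "p \<in> I \<Longrightarrow> u \<in> P \<Longrightarrow> u * p \<in> I" "p \<in> I \<Longrightarrow> u \<in> P \<Longrightarrow> p * u \<in> I"
  using additive_subgroup.zero_closed[OF ideal.axioms(1)[OF ideal_I]]
    additive_subgroup.a_closed[OF ideal.axioms(1)[OF ideal_I]]
    ideal.I_l_closed[OF ideal_I] ideal.I_r_closed[OF ideal_I] by auto

lemma I_sum: "(\<And>i. i \<in> A \<Longrightarrow> f i \<in> I) \<Longrightarrow> (\<Sum>i\<in>A. f i) \<in> I"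
  by (induction A rule: infinite_finite_induct) (auto intro: I_closed)

lemma I_trans: "p - p' \<in> I \<Longrightarrow> p' - p'' \<in> I \<Longrightarrow> p - p'' \<in> I"
  using I_closed(2)[of "p - p'" "p' - p''"] by simp

text \<open>Turns a congruence of monomials into a rewrite rule applicable inside longer
  words.\<close>

lemma I_context:
  assumes "S c w - S c' w' \<in> I" "set u \<subseteq> B" "set v \<subseteq> B"
  shows "S (d * c) (u @ w @ v) - S (d * c') (u @ w' @ v) \<in> I"
proof -
  have "S d u * (S c w - S c' w') * S 1 v \<in> I"
    using assms by (intro I_closed free_alg_closed)
  then show ?thesis by (simp add: algebra_simps mult_single plus_fword_def)
qed

lemma I_square:
  assumes "i < n"
  shows "S 1 [\<epsilon> i, \<epsilon> i] - S (q i) [] \<in> I"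
proof -
  have "S 1 [\<epsilon> i, \<epsilon> i] - S (q i) [] \<in> clifford_relations B Q"
    using assms unfolding clifford_relations_def by (auto simp: zero_fword_def)
  then show ?thesis
    unfolding clifford_ideal_def
    using ring.genideal_self[OF ring_free_alg relations_closed] by blast
qed

lemma I_swap:
  assumes "i < n" "j < n" "i \<noteq> j"
  shows "S 1 [\<epsilon> i, \<epsilon> j] - S (-1) [\<epsilon> j, \<epsilon> i] \<in> I"
proof -
  have "S 1 [\<epsilon> i, \<epsilon> j] + S 1 [\<epsilon> j, \<epsilon> i] \<in> clifford_relations B Q"
    using assms inj unfolding clifford_relations_def by (auto simp: inj_on_def)
  then have "S 1 [\<epsilon> i, \<epsilon> j] + S 1 [\<epsilon> j, \<epsilon> i] \<in> I"
    unfolding clifford_ideal_def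
    using ring.genideal_self[OF ring_free_alg relations_closed] by blast
  then show ?thesis by (simp add: single_uminus)
qed

text \<open>Since \<open>i\<close> does not occur in \<open>js\<close>, each letter that is passed
  costs exactly one sign.\<close>

lemma I_move:
  assumes "i < n" "i \<notin> set js" "set js \<subseteq> {..<n}"
  shows "S 1 (\<epsilon> i # map \<epsilon> js) - S ((-1) ^ length js) (map \<epsilon> js @ [\<epsilon> i]) \<in> I"
  using assms(2,3)
proof (induction js)
  case Nil
  then show ?case by (simp add: I_closed)
next
  case (Cons j js)
  have "S 1 (\<epsilon> i # \<epsilon> j # map \<epsilon> js) - S (-1) (\<epsilon> j # \<epsilon> i # map \<epsilon> js) \<in> I"
    using I_context[OF I_swap[of i j], of "[]" "map \<epsilon> js" 1] assms(1) Cons.prems by auto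
  moreover have "S (-1) (\<epsilon> j # \<epsilon> i # map \<epsilon> js) -
      S (- ((-1) ^ length js)) (\<epsilon> j # map \<epsilon> js @ [\<epsilon> i]) \<in> I"
    using I_context[OF Cons.IH, of "[\<epsilon> j]" "[]" "-1"] Cons.prems by auto
  ultimately show ?case by (auto dest: I_trans)
qed

text \<open>The canonical word for the monomial \<open>e_x\<close>, with increasing indices.\<close>

definition support_word :: "(nat \<Rightarrow> nat) \<Rightarrow> 'g list" where
  "support_word x = map \<epsilon> (filter (\<lambda>j. x j = 1) [0..<n])"

lemma support_word_closed: "set (support_word x) \<subseteq> B"
  by (auto simp: support_word_def)

text \<open>On its way to its sorted place, \<open>e_i\<close> picks up one sign for each smaller
  index in the support; this is the sign in \<open>twist_unit\<close>. If \<open>e_i\<close> is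
  present already, the two copies merge into \<open>q i\<close>.\<close>

lemma I_reduce:
  assumes "i < n" "x \<in> Z2n n"
  shows "S 1 (\<epsilon> i # support_word x) -
    S (twist n q (ix_unit n i) x) (support_word (Z2n_add n (ix_unit n i) x)) \<in> I"
proof -
  define L where "L = filter (\<lambda>j. x j = 1) [0..<i]"
  define R where "R = filter (\<lambda>j. x j = 1) [Suc i..<n]"
  let ?x' = "Z2n_add n (ix_unit n i) x"
  have split: "[0..<n] = [0..<i] @ i # [Suc i..<n]"
    using assms(1) upt_add_eq_append[of 0 i "n - i"] by (simp add: upt_conv_Cons)
  have x: "support_word x = map \<epsilon> L @ (if x i = 1 then [\<epsilon> i] else []) @ map \<epsilon> R"
    unfolding support_word_def split L_def R_def by simp
  have "filter (\<lambda>j. ?x' j = 1) [0..<i] = L" "filter (\<lambda>j. ?x' j = 1) [Suc i..<n] = R"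
  proof -
    have "?x' j = x j" if "j < n" "j \<noteq> i" for j
      using that assms Z2n_mem[OF assms(2), of j] by auto
    then show "filter (\<lambda>j. ?x' j = 1) [0..<i] = L" "filter (\<lambda>j. ?x' j = 1) [Suc i..<n] = R"
      unfolding L_def R_def using assms by (auto intro!: filter_cong)
  qed
  then have x': "support_word ?x' = map \<epsilon> L @ (if x i = 1 then [] else [\<epsilon> i]) @ map \<epsilon> R"
    unfolding support_word_def split using assms Z2n_mem[OF assms(2,1)] by auto
  have L: "set L \<subseteq> {..<n}" "i \<notin> set L" "length L = (\<Sum>j<i. x j)"
  proof -
    have "length L = card {j \<in> {..<i}. x j = 1}"
      unfolding L_def by (subst distinct_card[symmetric]) (auto intro: arg_cong[of _ _ card])
    also have "\<dots> = (\<Sum>j<i. if x j = 1 then 1 else 0)"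
      by (simp add: sum.If_cases Int_def)
    also have "\<dots> = (\<Sum>j<i. x j)"
    proof (rule sum.cong)
      fix j assume "j \<in> {..<i}"
      then show "(if x j = 1 then 1 else 0) = x j"
        using assms Z2n_mem[OF assms(2), of j] by auto
    qed simp
    finally show "length L = (\<Sum>j<i. x j)" .
  qed (use assms in \<open>auto simp: L_def\<close>)
  have R: "set (map \<epsilon> R) \<subseteq> B" by (auto simp: R_def)
  have LB: "set (map \<epsilon> L) \<subseteq> B" using L by auto
  have move: "S 1 (\<epsilon> i # map \<epsilon> L @ v) - S ((-1) ^ length L) (map \<epsilon> L @ \<epsilon> i # v) \<in> I"
    if "set v \<subseteq> B" for v
    using I_context[OF I_move[OF assms(1) L(2,1)], of "[]" v 1] that by simp
  show ?thesis
  proof (cases "x i = 1")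
    case True
    have "S 1 (\<epsilon> i # map \<epsilon> L @ \<epsilon> i # map \<epsilon> R) -
        S ((-1) ^ length L) (map \<epsilon> L @ \<epsilon> i # \<epsilon> i # map \<epsilon> R) \<in> I"
      using move[of "\<epsilon> i # map \<epsilon> R"] R assms by auto
    moreover have "S ((-1) ^ length L) (map \<epsilon> L @ \<epsilon> i # \<epsilon> i # map \<epsilon> R) -
        S ((-1) ^ length L * q i) (map \<epsilon> L @ map \<epsilon> R) \<in> I"
      using I_context[OF I_square[OF assms(1)] LB R, of "(-1) ^ length L"] by simp
    ultimately show ?thesis
      using True by (auto simp: x x' twist_unit assms L(3) dest: I_trans)
  next
    case False
    then have "x i = 0" using Z2n_mem[OF assms(2,1)] by simp
    then show ?thesis using move[OF R] by (simp add: x x' twist_unit assms L(3))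
  qed
qed

text \<open>Insertion sort: the tail is sorted by induction, and \<open>I_reduce\<close> inserts the
  first letter.\<close>

lemma I_normal_form:
  "set w \<subseteq> B \<Longrightarrow> S 1 w - S (word_scalar w) (support_word (word_ix w)) \<in> I"
proof (induction w)
  case Nil
  have "support_word (ix_zero n) = []" by (simp add: support_word_def)
  then show ?case by (simp add: I_closed)
next
  case (Cons g w)
  then obtain i where i: "i < n" "g = \<epsilon> i" by auto
  have "S 1 (\<epsilon> i # w) - S (word_scalar w) (\<epsilon> i # support_word (word_ix w)) \<in> I"
    using I_context[OF Cons.IH, of "[\<epsilon> i]" "[]" 1] i Cons.prems by auto
  moreover have "S (word_scalar w) (\<epsilon> i # support_word (word_ix w)) -
      S (word_scalar w * twist n q (ix_unit n i) (word_ix w))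
        (support_word (Z2n_add n (ix_unit n i) (word_ix w))) \<in> I"
    using I_context[OF I_reduce[OF i(1) word_ix_closed[of w]], of "[]" "[]" "word_scalar w"] by simp
  ultimately have "S 1 (\<epsilon> i # w) - S (word_scalar w * twist n q (ix_unit n i) (word_ix w))
        (support_word (Z2n_add n (ix_unit n i) (word_ix w))) \<in> I" by (rule I_trans)
  then show ?case using i by (simp add: mult.commute)
qed

text \<open>Modulo \<open>I\<close> every word becomes a multiple of a support word. Collecting
  equal support words leaves the coefficients \<open>eta p x\<close>, which all vanish.\<close>

lemma eta_zero_in_I:
  assumes "p \<in> P" "eta p = (\<lambda>x. 0)"
  shows "p \<in> I"
proof -
  let ?c = "\<lambda>s. Poly_Mapping.lookup p s * word_scalar (letters s)"
  let ?x = "\<lambda>s. word_ix (letters s)"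
  have "(\<Sum>s\<in>Poly_Mapping.keys p. Poly_Mapping.single s (Poly_Mapping.lookup p s) -
      S (?c s) (support_word (?x s))) \<in> I"
  proof (rule I_sum)
    fix s assume "s \<in> Poly_Mapping.keys p"
    then have "set (letters s) \<subseteq> B" using assms(1) by (auto simp: carrier_free_alg)
    from I_context[OF I_normal_form[OF this], of "[]" "[]" "Poly_Mapping.lookup p s"]
    show "Poly_Mapping.single s (Poly_Mapping.lookup p s) - S (?c s) (support_word (?x s)) \<in> I"
      by simp
  qed
  moreover have "(\<Sum>s\<in>Poly_Mapping.keys p. S (?c s) (support_word (?x s))) = 0"
  proof -
    \<comment> \<open>Spreading the term over all indices \<open>x\<close> allows the sums over
      words and over indices to be exchanged.\<close>
    have "S (?c s) (support_word (?x s)) =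
        (\<Sum>x\<in>Z2n n. S (?c s * delta (?x s) x) (support_word x))" for s
    proof -
      have "(\<Sum>x\<in>Z2n n. S (?c s * delta (?x s) x) (support_word x)) =
          (\<Sum>x\<in>Z2n n. if x = ?x s then S (?c s) (support_word (?x s)) else 0)"
        by (rule sum.cong) (auto simp: delta_def)
      then show ?thesis by simp
    qed
    then have "(\<Sum>s\<in>Poly_Mapping.keys p. S (?c s) (support_word (?x s))) =
      (\<Sum>s\<in>Poly_Mapping.keys p. \<Sum>x\<in>Z2n n. S (?c s * delta (?x s) x) (support_word x))"
      by (rule sum.cong[OF refl])
    also have "\<dots> = (\<Sum>x\<in>Z2n n. S (\<Sum>s\<in>Poly_Mapping.keys p. ?c s * delta (?x s) x) (support_word x))"
      unfolding single_sum by (rule sum.swap)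
    also have "\<dots> = (\<Sum>x\<in>Z2n n. S (eta p x) (support_word x))"
      by (simp add: eta_def lin_def mult.assoc)
    finally show ?thesis using assms(2) by simp
  qed
  ultimately show ?thesis by (simp add: sum_subtractf flip: pm_expand)
qed

text \<open>One inclusion is the reduction to normal forms. The other follows from minimality of the
  generated ideal, because the kernel of \<open>eta\<close> is an ideal that contains the relations;
  it rules out any collapse among the monomials \<open>e_x\<close>.\<close>

lemma I_kernel: "I = {p \<in> P. eta p = (\<lambda>x. 0)}"
proof
  let ?J = "{p \<in> P. eta p = (\<lambda>x. 0)}"
  show "?J \<subseteq> I" using eta_zero_in_I by auto
  have "ideal ?J (free_alg B)"
  proof (rule idealI[OF ring_free_alg])
    have inv: "inv\<^bsub>add_monoid (free_alg B)\<^esub> p = - p" if "p \<in> P" for p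
      using that abelian_group.minus_equality[OF ring.is_abelian_group[OF ring_free_alg], where x = p and y = "- p"]
      by (auto simp: a_inv_def intro: free_alg_closed)
    show "subgroup ?J (add_monoid (free_alg B))"
    proof (rule group.subgroupI[OF abelian_group.a_group[OF ring.is_abelian_group[OF ring_free_alg]]])
      show "inv\<^bsub>add_monoid (free_alg B)\<^esub> p \<in> ?J" if "p \<in> ?J" for p
        using that eta_linear(3)[of 0 p] inv[of p] by (auto intro: free_alg_closed)
    qed (use eta_linear(1) in \<open>auto intro: free_alg_closed\<close>)
  qed (auto intro: free_alg_closed)
  moreover have "clifford_relations B Q \<subseteq> ?J"
  proof
    fix r assume r: "r \<in> clifford_relations B Q"
    have "eta r = (\<lambda>x. 0)"
    proof -
      consider i where "i < n" "r = S 1 [\<epsilon> i, \<epsilon> i] - Poly_Mapping.single 0 (q i)"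
        | i j where "i < n" "j < n" "i \<noteq> j" "r = S 1 [\<epsilon> i, \<epsilon> j] + S 1 [\<epsilon> j, \<epsilon> i]"
        using r unfolding clifford_relations_def by fastforce
      then show ?thesis
      proof cases
        case 1
        then show ?thesis by (simp add: twist_unit)
      next
        case 2
        have rho: "rho n (ix_unit n k) = 1" if "k < n" for k using that by (simp add: rho_def)
        have "dot n (ix_unit n j) (ix_unit n i) = 0" using 2 by (simp add: dot_def)
        then have "twist n q (ix_unit n j) (ix_unit n i) = - twist n q (ix_unit n i) (ix_unit n j)"
          using 2 by (subst twist_commute) (simp add: rho)
        then show ?thesis using 2 by (simp add: Z2n_add_commute)
      qed
    qed
    then show "r \<in> ?J" using r relations_closed by auto
  qed
  ultimately show "I \<subseteq> ?J"
    unfolding clifford_ideal_def by (rule ring.genideal_minimal[OF ring_free_alg])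
qed

end

section \<open>Coordinates on the Clifford algebra\<close>

context clifford_gens
begin

text \<open>The element of the Clifford algebra with coordinates \<open>a\<close>: cosets of the
  kernel are the nonempty fibres of \<open>eta\<close>.\<close>

definition phi :: "((nat \<Rightarrow> nat) \<Rightarrow> 'k) \<Rightarrow> ('g fword \<Rightarrow>\<^sub>0 'k) set" where
  "phi a = {p \<in> P. eta p = a}"

lemma coset_eq_phi: "p \<in> P \<Longrightarrow> I +>\<^bsub>free_alg B\<^esub> p = phi (eta p)"
proof -
  assume p: "p \<in> P"
  have "v \<in> I +>\<^bsub>free_alg B\<^esub> p \<longleftrightarrow> v \<in> phi (eta p)" for v
  proof -
    have "v \<in> I +>\<^bsub>free_alg B\<^esub> p \<longleftrightarrow> v - p \<in> I"
      by (auto simp: a_r_coset_def r_coset_def intro!: bexI[of _ "v - p"])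
    also have "\<dots> \<longleftrightarrow> v \<in> phi (eta p)"
    proof
      assume "v - p \<in> I"
      then have "v - p \<in> P" "eta (v - p) = (\<lambda>x. 0)" unfolding I_kernel by auto
      then show "v \<in> phi (eta p)"
        using p free_alg_closed(3)[of "v - p" B p] by (simp add: phi_def fun_eq_iff)
    next
      assume "v \<in> phi (eta p)"
      then show "v - p \<in> I" using p by (auto simp: phi_def I_kernel intro: free_alg_closed)
    qed
    finally show ?thesis .
  qed
  then show ?thesis by blast
qed

section \<open>The monomials in coordinates\<close>

definition tail :: "nat \<Rightarrow> (nat \<Rightarrow> nat) \<Rightarrow> nat \<Rightarrow> nat" where
  "tail k x = (\<lambda>i\<in>{..<n}. if k \<le> i then x i else 0)"

lemma tail_closed [simp]: "x \<in> Z2n n \<Longrightarrow> tail k x \<in> Z2n n"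
  unfolding tail_def using Z2n_mem[of x n] by (intro restrict_in_Z2n) auto

lemma tail_0: "x \<in> Z2n n \<Longrightarrow> tail 0 x = x"
  by (intro Z2n_eqI[of _ n]) (auto, simp add: tail_def)

lemma tail_n: "tail n x = ix_zero n"
  by (auto simp: tail_def ix_zero_def restrict_def)

text \<open>The factor \<open>e_k\<close> is put in front of factors of larger index only, so
  neither a sign nor a value of the form arises.\<close>

lemma tail_Suc:
  assumes "x \<in> Z2n n" "k < n"
  shows "x k = 1 \<Longrightarrow> Z2n_add n (ix_unit n k) (tail (Suc k) x) = tail k x"
    "x k = 0 \<Longrightarrow> tail (Suc k) x = tail k x"
    "twist n q (ix_unit n k) (tail (Suc k) x) = 1"
proof -
  show "Z2n_add n (ix_unit n k) (tail (Suc k) x) = tail k x" if "x k = 1"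
  proof (rule Z2n_eqI[of _ n])
    fix i assume "i < n"
    then show "Z2n_add n (ix_unit n k) (tail (Suc k) x) i = tail k x i"
      using that Z2n_mem[OF assms(1), of i] by (cases "i = k") (auto simp: tail_def)
  qed (use assms in auto)
  show "tail (Suc k) x = tail k x" if "x k = 0"
    using that by (auto simp: tail_def restrict_def fun_eq_iff Suc_le_eq le_less)
  show "twist n q (ix_unit n k) (tail (Suc k) x) = 1"
    using assms(2) by (simp add: twist_unit tail_def)
qed

lemma word_ix_support_word:
  assumes "x \<in> Z2n n"
  shows "word_ix (support_word x) = x" "word_scalar (support_word x) = 1"
proof -
  define w where "w k = map \<epsilon> (filter (\<lambda>j. x j = 1) [k..<n])" for k
  have "word_ix (w k) = tail k x \<and> word_scalar (w k) = 1" if "k \<le> n" for k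
    using that
  proof (induction rule: inc_induct)
    case base
    show ?case by (simp add: w_def tail_n)
  next
    case (step k)
    show ?case
    proof (cases "x k = 1")
      case True
      then have "w k = \<epsilon> k # w (Suc k)" using step.hyps by (simp add: w_def upt_conv_Cons)
      then show ?thesis using step True by (simp add: tail_Suc assms)
    next
      case False
      then have "w k = w (Suc k)" using step.hyps by (simp add: w_def upt_conv_Cons)
      moreover have "x k = 0" using False Z2n_mem[OF assms step.hyps(2)] by auto
      ultimately show ?thesis using step by (simp add: tail_Suc assms)
    qed
  qed
  from this[of 0] show "word_ix (support_word x) = x" "word_scalar (support_word x) = 1"
    using assms by (simp_all add: w_def support_word_def tail_0)
qed

lemma eta_surj:
  assumes "a \<in> coords n"
  shows "\<exists>p\<in>P. eta p = a"
proof (rule bexI)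
  show "eta (\<Sum>x\<in>Z2n n. S (a x) (support_word x)) = a"
  proof -
    have "eta (\<Sum>x\<in>Z2n n. S (a x) (support_word x)) = (\<lambda>y. \<Sum>x\<in>Z2n n. a x * delta x y)"
      by (simp add: word_ix_support_word)
    then show ?thesis using coords_expand[OF assms] by simp
  qed
  show "(\<Sum>x\<in>Z2n n. S (a x) (support_word x)) \<in> P"
    by (intro free_alg_sum free_alg_closed support_word_closed)
qed

lemma phi_nonempty: "a \<in> coords n \<Longrightarrow> phi a \<noteq> {}"
  using eta_surj by (auto simp: phi_def)

lemma inj_phi: "inj_on phi (coords n)"
proof (rule inj_onI)
  fix a b assume "a \<in> coords n" "b \<in> coords n" "phi a = phi b"
  then show "a = b" using eta_surj[of a] unfolding phi_def by blast
qed

lemma carrier_C: "carrier C = phi ` coords n"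
proof -
  have "carrier C = (\<lambda>p. I +>\<^bsub>free_alg B\<^esub> p) ` P"
    by (auto simp: clifford_def Let_def FactRing_simps)
  also have "\<dots> = (\<lambda>p. phi (eta p)) ` P"
    by (rule image_cong) (simp_all add: coset_eq_phi)
  also have "\<dots> = phi ` coords n"
    using eta_surj by (auto simp: image_iff)
  finally show ?thesis .
qed

lemma C_simps:
  "\<zero>\<^bsub>C\<^esub> = phi (\<lambda>x. 0)"
  "\<one>\<^bsub>C\<^esub> = phi (delta (ix_zero n))"
  "a \<in> coords n \<Longrightarrow> b \<in> coords n \<Longrightarrow> phi a \<oplus>\<^bsub>C\<^esub> phi b = phi (\<lambda>x. a x + b x)"
  "a \<in> coords n \<Longrightarrow> b \<in> coords n \<Longrightarrow> phi a \<otimes>\<^bsub>C\<^esub> phi b = phi (conv n q a b)"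
  "a \<in> coords n \<Longrightarrow> c \<odot>\<^bsub>C\<^esub> phi a = phi (\<lambda>x. c * a x)"
proof -
  show "\<zero>\<^bsub>C\<^esub> = phi (\<lambda>x. 0)"
    by (simp add: clifford_def Let_def FactRing_def I_kernel phi_def)
  show "\<one>\<^bsub>C\<^esub> = phi (delta (ix_zero n))"
    by (simp add: clifford_def Let_def FactRing_def coset_eq_phi free_alg_closed)
  show "phi a \<otimes>\<^bsub>C\<^esub> phi b = phi (conv n q a b)" if "a \<in> coords n" "b \<in> coords n"
  proof -
    have "phi a \<otimes>\<^bsub>C\<^esub> phi b = (\<Union>u\<in>phi a. \<Union>v\<in>phi b. I +>\<^bsub>free_alg B\<^esub> (u * v))"
      by (simp add: clifford_def Let_def FactRing_def rcoset_mult_def)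
    also have "\<dots> = phi (conv n q a b)"
      by (intro UN_const phi_nonempty that) (auto simp: phi_def coset_eq_phi free_alg_closed)
    finally show ?thesis .
  qed
  show "c \<odot>\<^bsub>C\<^esub> phi a = phi (\<lambda>x. c * a x)" if "a \<in> coords n"
  proof -
    have "c \<odot>\<^bsub>C\<^esub> phi a = (\<Union>u\<in>phi a. I +>\<^bsub>free_alg B\<^esub> (pm_scale c u))"
      by (simp add: clifford_def Let_def FactRing_def)
    also have "\<dots> = phi (\<lambda>x. c * a x)"
      by (intro UN_const phi_nonempty that) (auto simp: phi_def coset_eq_phi free_alg_closed)
    finally show ?thesis .
  qed
  show "phi a \<oplus>\<^bsub>C\<^esub> phi b = phi (\<lambda>x. a x + b x)" if "a \<in> coords n" "b \<in> coords n"
  proof -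
    have "phi a \<oplus>\<^bsub>C\<^esub> phi b = (\<Union>u\<in>phi a. \<Union>v\<in>phi b. {u + v})"
      by (auto simp: clifford_def Let_def FactRing_def set_add_def set_mult_def)
    also have "\<dots> = phi (\<lambda>x. a x + b x)"
    proof
      show "(\<Union>u\<in>phi a. \<Union>v\<in>phi b. {u + v}) \<subseteq> phi (\<lambda>x. a x + b x)"
        by (auto simp: phi_def free_alg_closed)
      \<comment> \<open>Cosets are added elementwise, so each element of the target has to be split
        itself: a fixed representative \<open>u\<close> of the first summand is subtracted from
        it.\<close>
      from eta_surj[OF that(1)] obtain u where u: "u \<in> P" "eta u = a" by blast
      show "phi (\<lambda>x. a x + b x) \<subseteq> (\<Union>u\<in>phi a. \<Union>v\<in>phi b. {u + v})"
      proof
        fix v assume "v \<in> phi (\<lambda>x. a x + b x)"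
        then have "v - u \<in> phi b" "v = u + (v - u)" using u by (auto simp: phi_def free_alg_closed)
        moreover have "u \<in> phi a" using u by (simp add: phi_def)
        ultimately show "v \<in> (\<Union>u\<in>phi a. \<Union>v\<in>phi b. {u + v})" by blast
      qed
    qed
    finally show ?thesis .
  qed
qed

lemma phi_alg_iso: "phi \<in> alg_iso (coord_alg n q) C"
  unfolding alg_iso_def ring_iso_def
  by (auto simp: ring_hom_def carrier_C C_simps bij_betw_def inj_phi)

lemma clifford_gen_eq: "i < n \<Longrightarrow> clifford_gen B Q (\<epsilon> i) = phi (delta (ix_unit n i))"
  unfolding clifford_gen_def by (subst coset_eq_phi) (auto intro: free_alg_closed)

text \<open>\<open>foldr\<close> builds the product from its right end, so the partial products are
  the truncations of \<open>x\<close>, and by \<open>tail_Suc\<close> no scalar enters.\<close>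

lemma clifford_mono_eq:
  assumes "x \<in> Z2n n"
  shows "clifford_mono n \<epsilon> Q x = phi (delta x)"
proof -
  have "foldr (\<lambda>i a. (clifford_gen B Q (\<epsilon> i) [^]\<^bsub>C\<^esub> x i) \<otimes>\<^bsub>C\<^esub> a) [k..<n] \<one>\<^bsub>C\<^esub> = phi (delta (tail k x))"
    if "k \<le> n" for k
    using that
  proof (induction rule: inc_induct)
    case base
    then show ?case by (simp add: C_simps tail_n)
  next
    case (step k)
    let ?g = "clifford_gen B Q (\<epsilon> k)"
    have "?g [^]\<^bsub>C\<^esub> x k \<otimes>\<^bsub>C\<^esub> phi (delta (tail (Suc k) x)) = phi (delta (tail k x))"
    proof (cases "x k = 1")
      case True
      then have "?g [^]\<^bsub>C\<^esub> x k = phi (delta (ix_unit n k))"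
        using step.hyps by (simp add: nat_pow_def clifford_gen_eq C_simps conv_delta)
      then show ?thesis using True step.hyps by (simp add: C_simps conv_delta tail_Suc assms)
    next
      case False
      then have "x k = 0" using Z2n_mem[OF assms step.hyps(2)] by auto
      then show ?thesis
        using step.hyps by (simp add: nat_pow_def C_simps conv_delta tail_Suc assms)
    qed
    then show ?case using step by (simp add: upt_conv_Cons)
  qed
  from this[of 0] show ?thesis
    using assms by (simp add: clifford_mono_def Let_def tail_0)
qed

section \<open>The grading by parity\<close>

lemma abelian_monoid_C: "abelian_monoid C"
  by (rule abelian_monoidI) (auto simp: carrier_C C_simps add_ac)

lemma finsum_C:
  assumes "finite A" "\<And>i. i \<in> A \<Longrightarrow> f i \<in> coords n"
  shows "finsum C (\<lambda>i. phi (f i)) A = phi (\<lambda>x. \<Sum>i\<in>A. f i x)"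
  using assms
proof (induction A)
  case empty
  show ?case by (simp add: abelian_monoid.finsum_empty[OF abelian_monoid_C] C_simps)
next
  case (insert i A)
  then have "finsum C (\<lambda>i. phi (f i)) (insert i A) = phi (f i) \<oplus>\<^bsub>C\<^esub> phi (\<lambda>x. \<Sum>i\<in>A. f i x)"
    by (subst abelian_monoid.finsum_insert[OF abelian_monoid_C]) (auto simp: carrier_C)
  then show ?case using insert by (simp add: C_simps)
qed

lemma clifford_part_eq:
  "clifford_part n \<epsilon> Q d = phi ` {a \<in> coords n. \<forall>x. a x \<noteq> 0 \<longrightarrow> rho n x mod 2 = d}"
proof -
  let ?D = "{x \<in> Z2n n. rho n x mod 2 = d}"
  have *: "finsum C (\<lambda>x. c x \<odot>\<^bsub>C\<^esub> clifford_mono n \<epsilon> Q x) ?D =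
      phi (\<lambda>y. if y \<in> ?D then c y else 0)" for c
  proof -
    have "finsum C (\<lambda>x. c x \<odot>\<^bsub>C\<^esub> clifford_mono n \<epsilon> Q x) ?D =
        finsum C (\<lambda>x. phi (\<lambda>y. c x * delta x y)) ?D"
      by (rule abelian_monoid.finsum_cong'[OF abelian_monoid_C])
        (auto simp: clifford_mono_eq C_simps carrier_C)
    also have "\<dots> = phi (\<lambda>y. \<Sum>x\<in>?D. c x * delta x y)"
      by (rule finsum_C) auto
    also have "(\<lambda>y. \<Sum>x\<in>?D. c x * delta x y) = (\<lambda>y. if y \<in> ?D then c y else 0)"
    proof
      fix y
      have "(\<Sum>x\<in>?D. c x * delta x y) = (\<Sum>x\<in>?D. if x = y then c x else 0)"
        by (rule sum.cong) (auto simp: delta_def)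
      then show "(\<Sum>x\<in>?D. c x * delta x y) = (if y \<in> ?D then c y else 0)" by simp
    qed
    finally show ?thesis .
  qed
  show ?thesis
  proof (intro equalityI subsetI)
    fix X assume "X \<in> clifford_part n \<epsilon> Q d"
    then obtain c where "X = phi (\<lambda>y. if y \<in> ?D then c y else 0)"
      by (auto simp: clifford_part_def Let_def *)
    then show "X \<in> phi ` {a \<in> coords n. \<forall>x. a x \<noteq> 0 \<longrightarrow> rho n x mod 2 = d}"
      by (auto simp: coords_def split: if_splits)
  next
    fix X assume "X \<in> phi ` {a \<in> coords n. \<forall>x. a x \<noteq> 0 \<longrightarrow> rho n x mod 2 = d}"
    then obtain a where a: "X = phi a" "a \<in> coords n" "\<And>x. a x \<noteq> 0 \<Longrightarrow> rho n x mod 2 = d"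
      by auto
    then have "a = (\<lambda>y. if y \<in> ?D then a y else 0)" by (auto simp: coords_def fun_eq_iff)
    then have "X = finsum C (\<lambda>x. a x \<odot>\<^bsub>C\<^esub> clifford_mono n \<epsilon> Q x) ?D" using * a(1) by metis
    then show "X \<in> clifford_part n \<epsilon> Q d" by (auto simp: clifford_part_def Let_def)
  qed
qed

text \<open>Even and odd elements have disjoint supports. Restriction therefore gives the
  decomposition, and at each index only one of the two summands can be nonzero, so it is
  unique.\<close>

lemma hom_part_eq:
  assumes "a \<in> coords n" "d \<in> {0, 1}"
  shows "hom_part C (clifford_part n \<epsilon> Q) d (phi a) =
    phi (\<lambda>x. if rho n x mod 2 = d then a x else 0)"
proof -
  have aux: "(if rho n x mod 2 = d then a x else 0) + (if rho n x mod 2 = 1 - d then a x else 0) = a x"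
    for x using assms(2) by auto
  show ?thesis
    unfolding hom_part_def clifford_part_eq
  proof (rule the_equality)
    let ?a = "\<lambda>d x. if rho n x mod 2 = d then a x else 0"
    have coords: "?a d' \<in> coords n" for d' using assms(1) by (auto simp: coords_def)
    have "phi a = phi (?a d) \<oplus>\<^bsub>C\<^esub> phi (?a (1 - d))"
      using C_simps(3)[OF coords coords, of d "1 - d"] by (simp only: aux)
    moreover have "phi (?a d') \<in> phi ` {a \<in> coords n. \<forall>x. a x \<noteq> 0 \<longrightarrow> rho n x mod 2 = d'}" for d'
      using coords by (auto split: if_splits)
    ultimately show "phi (?a d) \<in> phi ` {a \<in> coords n. \<forall>x. a x \<noteq> 0 \<longrightarrow> rho n x mod 2 = d} \<and>
      (\<exists>a''\<in>phi ` {a \<in> coords n. \<forall>x. a x \<noteq> 0 \<longrightarrow> rho n x mod 2 = 1 - d}.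
        phi a = phi (?a d) \<oplus>\<^bsub>C\<^esub> a'')" by (intro conjI bexI)
  next
    fix X
    assume "X \<in> phi ` {a \<in> coords n. \<forall>x. a x \<noteq> 0 \<longrightarrow> rho n x mod 2 = d} \<and>
      (\<exists>a''\<in>phi ` {a \<in> coords n. \<forall>x. a x \<noteq> 0 \<longrightarrow> rho n x mod 2 = 1 - d}. phi a = X \<oplus>\<^bsub>C\<^esub> a'')"
    then obtain b b' where b: "X = phi b" "b \<in> coords n" "\<And>x. b x \<noteq> 0 \<Longrightarrow> rho n x mod 2 = d"
        "b' \<in> coords n" "\<And>x. b' x \<noteq> 0 \<Longrightarrow> rho n x mod 2 = 1 - d" "phi a = phi b \<oplus>\<^bsub>C\<^esub> phi b'"
      by auto
    then have "a = (\<lambda>x. b x + b' x)" using inj_phi assms(1) by (auto simp: C_simps dest: inj_onD)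
    then have "(if rho n x mod 2 = d then a x else 0) = b x" for x
      using b(3)[of x] b(5)[of x] assms(2) by (cases "b x = 0"; cases "b' x = 0") auto
    then show "X = phi (\<lambda>x. if rho n x mod 2 = d then a x else 0)" using b(1) by simp
  qed
qed

end

section \<open>Coordinates on the super tensor product\<close>

lemma module_pm_scale: "Modules.module (pm_scale :: 'k::field \<Rightarrow> ('s \<Rightarrow>\<^sub>0 'k) \<Rightarrow> _)"
  by unfold_locales (auto intro!: poly_mapping_eqI simp: lookup_add algebra_simps)

lemmas pm_span =
  Modules.module.span_base[OF module_pm_scale] Modules.module.span_zero[OF module_pm_scale]
  Modules.module.span_add[OF module_pm_scale] Modules.module.span_diff[OF module_pm_scale]
  Modules.module.span_scale[OF module_pm_scale] Modules.module.span_sum[OF module_pm_scale]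

lemma pm_scale_single [simp]:
  "pm_scale c (Poly_Mapping.single s d) = Poly_Mapping.single s (c * d)"
  by (rule poly_mapping_eqI) (simp add: lookup_single when_def)

lemma pm_scale_simps:
  "pm_scale c (p + p') = pm_scale c p + pm_scale c p'"
  "pm_scale c (p - p') = pm_scale c p - pm_scale c p'"
  "pm_scale c (\<Sum>i\<in>A. f i) = (\<Sum>i\<in>A. pm_scale c (f i))"
  by (auto intro!: poly_mapping_eqI simp: lookup_add lookup_minus lookup_sum algebra_simps
      sum_distrib_left)

context clifford_gens
begin

abbreviation "R \<equiv> module.span pm_scale (tensor_relations C C)"
abbreviation "E x \<equiv> phi (delta x)"
abbreviation "T \<equiv> super_tensor C (clifford_part n \<epsilon> Q) C (clifford_part n \<epsilon> Q)"
abbreviation "single2 X Y c \<equiv> Poly_Mapping.single (X, Y) (c :: 'k)"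

definition PT :: "((('g fword \<Rightarrow>\<^sub>0 'k) set \<times> ('g fword \<Rightarrow>\<^sub>0 'k) set) \<Rightarrow>\<^sub>0 'k) set" where
  "PT = {u. Poly_Mapping.keys u \<subseteq> carrier C \<times> carrier C}"

definition kappa :: "('g fword \<Rightarrow>\<^sub>0 'k) set \<Rightarrow> (nat \<Rightarrow> nat) \<Rightarrow> 'k" where
  "kappa = the_inv_into (coords n) phi"

lemma kappa_phi [simp]: "a \<in> coords n \<Longrightarrow> kappa (phi a) = a"
  by (simp add: kappa_def the_inv_into_f_f inj_phi)

lemma kappa_closed [simp]: "X \<in> carrier C \<Longrightarrow> kappa X \<in> coords n"
  and phi_kappa [simp]: "X \<in> carrier C \<Longrightarrow> phi (kappa X) = X"
  by (auto simp: carrier_C)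

lemma phi_closed [simp]: "a \<in> coords n \<Longrightarrow> phi a \<in> carrier C"
  by (simp add: carrier_C)

text \<open>Coordinates of a pure tensor. Storing a pair of indices as one index of length
  \<open>n + n\<close> lets the super tensor product share a coordinate algebra with the Clifford
  algebra of \<open>V \<oplus> V\<close>.\<close>

definition pair_coords ::
    "(('g fword \<Rightarrow>\<^sub>0 'k) set \<times> ('g fword \<Rightarrow>\<^sub>0 'k) set) \<Rightarrow> (nat \<Rightarrow> nat) \<Rightarrow> 'k" where
  "pair_coords s w = (if w \<in> Z2n (n + n)
     then kappa (fst s) (ix_fst n w) * kappa (snd s) (ix_snd n w) else 0)"

definition tau ::
    "((('g fword \<Rightarrow>\<^sub>0 'k) set \<times> ('g fword \<Rightarrow>\<^sub>0 'k) set) \<Rightarrow>\<^sub>0 'k) \<Rightarrow> (nat \<Rightarrow> nat) \<Rightarrow> 'k" where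
  "tau = lin pair_coords"

lemma tau_closed [simp]: "tau u \<in> coords (n + n)"
  unfolding tau_def lin_def by (intro coords_sum coords_closed) (simp add: coords_def pair_coords_def)

lemma tau_linear [simp]:
  "tau 0 = (\<lambda>w. 0)" "tau (u + u') = (\<lambda>w. tau u w + tau u' w)"
  "tau (u - u') = (\<lambda>w. tau u w - tau u' w)" "tau (pm_scale c u) = (\<lambda>w. c * tau u w)"
  "tau (\<Sum>i\<in>A. f i) = (\<lambda>w. \<Sum>i\<in>A. tau (f i) w)"
  "tau (Poly_Mapping.single s c) = (\<lambda>w. c * pair_coords s w)"
  unfolding tau_def by (simp_all add: lin_add lin_diff lin_scale lin_sum fun_eq_iff)

lemma pair_coords_delta:
  assumes "x \<in> Z2n n" "y \<in> Z2n n"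
  shows "pair_coords (E x, E y) = delta (ix_pair n x y)"
proof
  fix w
  have "w \<in> Z2n (n + n) \<Longrightarrow> w = ix_pair n x y \<longleftrightarrow> ix_fst n w = x \<and> ix_snd n w = y"
    using assms ix_pair_fst_snd by fastforce
  then show "pair_coords (E x, E y) w = delta (ix_pair n x y) w"
    using assms by (simp add: pair_coords_def) (auto simp: delta_def)
qed

lemma PT_closed:
  "0 \<in> PT" "u \<in> PT \<Longrightarrow> v \<in> PT \<Longrightarrow> u + v \<in> PT" "u \<in> PT \<Longrightarrow> v \<in> PT \<Longrightarrow> u - v \<in> PT"
  "u \<in> PT \<Longrightarrow> pm_scale c u \<in> PT"
  "X \<in> carrier C \<Longrightarrow> Y \<in> carrier C \<Longrightarrow> single2 X Y c \<in> PT"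
  using keys_add[of u v] keys_diff[of u v] keys_pm_scale[of c u] unfolding PT_def by (auto split: if_splits)

lemma PT_sum: "(\<And>i. i \<in> A \<Longrightarrow> f i \<in> PT) \<Longrightarrow> (\<Sum>i\<in>A. f i) \<in> PT"
  by (induction A rule: infinite_finite_induct) (auto intro: PT_closed)

lemma R_trans: "u - v \<in> R \<Longrightarrow> v - w \<in> R \<Longrightarrow> u - w \<in> R"
  using pm_span(3)[of "u - v" _ "v - w"] by simp

lemma C_closed:
  "X \<in> carrier C \<Longrightarrow> Y \<in> carrier C \<Longrightarrow> X \<oplus>\<^bsub>C\<^esub> Y \<in> carrier C"
  "X \<in> carrier C \<Longrightarrow> Y \<in> carrier C \<Longrightarrow> X \<otimes>\<^bsub>C\<^esub> Y \<in> carrier C"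
  "X \<in> carrier C \<Longrightarrow> c \<odot>\<^bsub>C\<^esub> X \<in> carrier C"
  by (auto simp: carrier_C C_simps)

lemma kappa_simps:
  "X \<in> carrier C \<Longrightarrow> Y \<in> carrier C \<Longrightarrow> kappa (X \<oplus>\<^bsub>C\<^esub> Y) = (\<lambda>x. kappa X x + kappa Y x)"
  "X \<in> carrier C \<Longrightarrow> Y \<in> carrier C \<Longrightarrow> kappa (X \<otimes>\<^bsub>C\<^esub> Y) = conv n q (kappa X) (kappa Y)"
  "X \<in> carrier C \<Longrightarrow> kappa (c \<odot>\<^bsub>C\<^esub> X) = (\<lambda>x. c * kappa X x)"
  by (auto simp: carrier_C C_simps)

lemma tensor_relationsI:
  assumes "X \<in> carrier C" "Y \<in> carrier C" "Z \<in> carrier C"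
  shows "single2 (X \<oplus>\<^bsub>C\<^esub> Y) Z 1 - single2 X Z 1 - single2 Y Z 1 \<in> R"
    "single2 X (Y \<oplus>\<^bsub>C\<^esub> Z) 1 - single2 X Y 1 - single2 X Z 1 \<in> R"
    "single2 (c \<odot>\<^bsub>C\<^esub> X) Y 1 - single2 X Y c \<in> R"
    "single2 X (c \<odot>\<^bsub>C\<^esub> Y) 1 - single2 X Y c \<in> R"
proof -
  show "single2 (X \<oplus>\<^bsub>C\<^esub> Y) Z 1 - single2 X Z 1 - single2 Y Z 1 \<in> R"
    by (intro pm_span(1)) (unfold tensor_relations_def, rule UnI1, rule UnI1, rule UnI1,
        intro CollectI exI conjI, rule refl, (rule assms)+)
  show "single2 X (Y \<oplus>\<^bsub>C\<^esub> Z) 1 - single2 X Y 1 - single2 X Z 1 \<in> R"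
    by (intro pm_span(1)) (unfold tensor_relations_def, rule UnI1, rule UnI1, rule UnI2,
        intro CollectI exI conjI, rule refl, (rule assms)+)
  show "single2 (c \<odot>\<^bsub>C\<^esub> X) Y 1 - single2 X Y c \<in> R"
    by (intro pm_span(1)) (unfold tensor_relations_def, rule UnI1, rule UnI2,
        intro CollectI exI conjI, rule refl, (rule assms)+)
  show "single2 X (c \<odot>\<^bsub>C\<^esub> Y) 1 - single2 X Y c \<in> R"
    by (intro pm_span(1)) (unfold tensor_relations_def, rule UnI2, intro CollectI exI conjI, rule refl, (rule assms)+)
qed

section \<open>The bilinearity relations as a kernel\<close>

lemma R_subset: "R \<subseteq> {u \<in> PT. tau u = (\<lambda>w. 0)}"
proof (rule Modules.module.span_minimal[OF module_pm_scale])
  show "tensor_relations C C \<subseteq> {u \<in> PT. tau u = (\<lambda>w. 0)}"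
    unfolding tensor_relations_def
    by (auto intro!: PT_closed C_closed
        simp: kappa_simps pair_coords_def ring_distribs fun_eq_iff)
  show "module.subspace pm_scale {u \<in> PT. tau u = (\<lambda>w. 0)}"
    by (rule Modules.module.subspaceI[OF module_pm_scale]) (use PT_closed in auto)
qed

lemma R_expand_left:
  assumes "finite A" "\<And>i. i \<in> A \<Longrightarrow> f i \<in> coords n" "Y \<in> carrier C"
  shows "single2 (phi (\<lambda>x. \<Sum>i\<in>A. c i * f i x)) Y 1 - (\<Sum>i\<in>A. single2 (phi (f i)) Y (c i)) \<in> R"
  using assms(1,2)
proof (induction A)
  case empty
  show ?case
    \<comment> \<open>The empty sum is the scaling relation with factor 0, whose second term is the
      zero formal sum.\<close>
    using tensor_relationsI(3)[of "phi (\<lambda>x. 0)" Y Y 0] assms(3) by (simp add: C_simps)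
next
  case (insert i A)
  let ?g = "\<lambda>x. \<Sum>i\<in>A. c i * f i x" and ?h = "\<lambda>x. c i * f i x"
  let ?a = "single2 (phi (\<lambda>x. \<Sum>i\<in>insert i A. c i * f i x)) Y 1"
    and ?b = "single2 (phi ?h) Y 1" and ?d = "single2 (phi ?g) Y 1"
    and ?e = "single2 (phi (f i)) Y (c i)" and ?s = "\<Sum>i\<in>A. single2 (phi (f i)) Y (c i)"
  have g: "?g \<in> coords n" "?h \<in> coords n" using insert by auto
  have "?a - ?b - ?d \<in> R"
    using tensor_relationsI(1)[of "phi ?h" "phi ?g" Y] assms(3) g insert by (simp add: C_simps)
  moreover have "?b - ?e \<in> R"
    using tensor_relationsI(3)[of "phi (f i)" Y Y "c i"] assms(3) insert.prems
    by (simp add: C_simps)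
  moreover have "?d - ?s \<in> R"
    using insert by simp
  ultimately have "(?a - ?b - ?d) + (?b - ?e) + (?d - ?s) \<in> R" by (intro pm_span(3))
  moreover have "(?a - ?b - ?d) + (?b - ?e) + (?d - ?s) = ?a - (?e + ?s)" by (simp only: algebra_simps)
  ultimately show ?case by (simp only: sum.insert[OF insert.hyps])
qed

lemma R_expand_right:
  assumes "finite A" "\<And>i. i \<in> A \<Longrightarrow> f i \<in> coords n" "Y \<in> carrier C"
  shows "single2 Y (phi (\<lambda>x. \<Sum>i\<in>A. c i * f i x)) 1 - (\<Sum>i\<in>A. single2 Y (phi (f i)) (c i)) \<in> R"
  using assms(1,2)
proof (induction A)
  case empty
  show ?case
    using tensor_relationsI(4)[of Y "phi (\<lambda>x. 0)" Y 0] assms(3) by (simp add: C_simps)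
next
  case (insert i A)
  let ?g = "\<lambda>x. \<Sum>i\<in>A. c i * f i x" and ?h = "\<lambda>x. c i * f i x"
  let ?a = "single2 Y (phi (\<lambda>x. \<Sum>i\<in>insert i A. c i * f i x)) 1"
    and ?b = "single2 Y (phi ?h) 1" and ?d = "single2 Y (phi ?g) 1"
    and ?e = "single2 Y (phi (f i)) (c i)" and ?s = "\<Sum>i\<in>A. single2 Y (phi (f i)) (c i)"
  have g: "?g \<in> coords n" "?h \<in> coords n" using insert by auto
  have "?a - ?b - ?d \<in> R"
    using tensor_relationsI(2)[of Y "phi ?h" "phi ?g"] assms(3) g insert by (simp add: C_simps)
  moreover have "?b - ?e \<in> R"
    using tensor_relationsI(4)[of Y "phi (f i)" Y "c i"] assms(3) insert.prems
    by (simp add: C_simps)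
  moreover have "?d - ?s \<in> R"
    using insert by simp
  ultimately have "(?a - ?b - ?d) + (?b - ?e) + (?d - ?s) \<in> R" by (intro pm_span(3))
  moreover have "(?a - ?b - ?d) + (?b - ?e) + (?d - ?s) = ?a - (?e + ?s)" by (simp only: algebra_simps)
  ultimately show ?case by (simp only: sum.insert[OF insert.hyps])
qed

text \<open>The left factor is expanded in the basis, then the right factor in each resulting
  term.\<close>

lemma R_expand:
  assumes "X \<in> carrier C" "Y \<in> carrier C"
  shows "single2 X Y d -
    (\<Sum>w\<in>Z2n (n + n). single2 (E (ix_fst n w)) (E (ix_snd n w)) (d * pair_coords (X, Y) w)) \<in> R"
proof -
  have phi_expand: "phi (\<lambda>y. \<Sum>x\<in>Z2n n. kappa Z x * delta x y) = Z" if "Z \<in> carrier C" for Z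
    using coords_expand[OF kappa_closed[OF that]] that by simp
  have "single2 X Y 1 - (\<Sum>x\<in>Z2n n. single2 (E x) Y (kappa X x)) \<in> R"
    using R_expand_left[of "Z2n n" delta Y "kappa X"] assms by (simp add: phi_expand)
  moreover have "(\<Sum>x\<in>Z2n n. pm_scale (kappa X x)
      (single2 (E x) Y 1 - (\<Sum>y\<in>Z2n n. single2 (E x) (E y) (kappa Y y)))) \<in> R"
    using R_expand_right[of "Z2n n" delta _ "kappa Y"] assms
    by (intro pm_span(5,6)) (simp add: phi_expand)
  then have "(\<Sum>x\<in>Z2n n. single2 (E x) Y (kappa X x)) -
      (\<Sum>x\<in>Z2n n. \<Sum>y\<in>Z2n n. single2 (E x) (E y) (kappa X x * kappa Y y)) \<in> R"
    by (simp add: pm_scale_simps sum_subtractf)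
  ultimately have "single2 X Y 1 -
      (\<Sum>x\<in>Z2n n. \<Sum>y\<in>Z2n n. single2 (E x) (E y) (kappa X x * kappa Y y)) \<in> R"
    by (rule R_trans)
  then have "pm_scale d (single2 X Y 1 -
      (\<Sum>x\<in>Z2n n. \<Sum>y\<in>Z2n n. single2 (E x) (E y) (kappa X x * kappa Y y))) \<in> R"
    by (rule pm_span)
  moreover have "(\<Sum>w\<in>Z2n (n + n). single2 (E (ix_fst n w)) (E (ix_snd n w)) (d * pair_coords (X, Y) w)) =
      (\<Sum>x\<in>Z2n n. \<Sum>y\<in>Z2n n. single2 (E x) (E y) (d * (kappa X x * kappa Y y)))"
    by (subst sum_Z2n_double[symmetric]) (simp add: pair_coords_def)
  ultimately show ?thesis by (simp add: pm_scale_simps)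
qed

text \<open>As for the Clifford ideal: modulo the relations, \<open>u\<close> is the combination of
  basis tensors with coefficients \<open>tau u w\<close>.\<close>

lemma R_kernel: "R = {u \<in> PT. tau u = (\<lambda>w. 0)}"
proof
  show "{u \<in> PT. tau u = (\<lambda>w. 0)} \<subseteq> R"
  proof clarify
    fix u assume u: "u \<in> PT" "tau u = (\<lambda>w. 0)"
    let ?E = "\<lambda>w. single2 (E (ix_fst n w)) (E (ix_snd n w))"
    have "(\<Sum>s\<in>Poly_Mapping.keys u. Poly_Mapping.single s (Poly_Mapping.lookup u s) -
        (\<Sum>w\<in>Z2n (n + n). ?E w (Poly_Mapping.lookup u s * pair_coords s w))) \<in> R"
    proof (rule pm_span(6))
      fix s assume "s \<in> Poly_Mapping.keys u"
      then show "Poly_Mapping.single s (Poly_Mapping.lookup u s) -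
        (\<Sum>w\<in>Z2n (n + n). ?E w (Poly_Mapping.lookup u s * pair_coords s w)) \<in> R"
        using R_expand[of "fst s" "snd s"] u(1) by (auto simp: PT_def)
    qed
    moreover have "(\<Sum>s\<in>Poly_Mapping.keys u.
        \<Sum>w\<in>Z2n (n + n). ?E w (Poly_Mapping.lookup u s * pair_coords s w)) = 0"
    proof -
      have "(\<Sum>s\<in>Poly_Mapping.keys u.
          \<Sum>w\<in>Z2n (n + n). ?E w (Poly_Mapping.lookup u s * pair_coords s w)) =
        (\<Sum>w\<in>Z2n (n + n). ?E w (tau u w))"
        unfolding tau_def lin_def single_sum by (rule sum.swap)
      then show ?thesis by (simp add: u(2))
    qed
    ultimately show "u \<in> R" by (simp add: sum_subtractf flip: pm_expand)
  qed
qed (rule R_subset)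

section \<open>The algebra structure of the super tensor product\<close>

definition phiT where "phiT t = {u \<in> PT. tau u = t}"

lemma tensor_class_eq: "u \<in> PT \<Longrightarrow> tensor_class C C u = phiT (tau u)"
proof -
  assume u: "u \<in> PT"
  have "v \<in> tensor_class C C u \<longleftrightarrow> v \<in> phiT (tau u)" for v
  proof -
    have "v \<in> tensor_class C C u \<longleftrightarrow> v - u \<in> R"
      unfolding tensor_class_def by (auto intro!: exI[of _ "v - u"])
    also have "\<dots> \<longleftrightarrow> v \<in> phiT (tau u)"
    proof
      assume "v - u \<in> R"
      then have "v - u \<in> PT" "tau (v - u) = (\<lambda>w. 0)" unfolding R_kernel by auto
      then show "v \<in> phiT (tau u)"
        using u PT_closed(2)[of "v - u" u] by (simp add: phiT_def fun_eq_iff)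
    next
      assume "v \<in> phiT (tau u)"
      then show "v - u \<in> R"
        using u PT_closed(3)[of v u] by (simp add: phiT_def R_kernel)
    qed
    finally show ?thesis .
  qed
  then show ?thesis by blast
qed

lemma tau_surj:
  assumes "t \<in> coords (n + n)"
  shows "\<exists>u\<in>PT. tau u = t"
proof (rule bexI)
  let ?u = "\<Sum>w\<in>Z2n (n + n). single2 (E (ix_fst n w)) (E (ix_snd n w)) (t w)"
  have "tau ?u = (\<lambda>v. \<Sum>w\<in>Z2n (n + n). t w * delta w v)"
    by (simp add: pair_coords_delta)
  then show "tau ?u = t" using coords_expand[OF assms] by simp
  show "?u \<in> PT" by (intro PT_sum PT_closed phi_closed coords_closed) auto
qed

lemma phiT_nonempty: "t \<in> coords (n + n) \<Longrightarrow> phiT t \<noteq> {}"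
  using tau_surj by (fastforce simp: phiT_def)

lemma inj_phiT: "inj_on phiT (coords (n + n))"
proof (rule inj_onI)
  fix s t assume "s \<in> coords (n + n)" "t \<in> coords (n + n)" "phiT s = phiT t"
  then show "s = t" using tau_surj[of s] unfolding phiT_def by blast
qed

lemma carrier_T: "carrier T = phiT ` coords (n + n)"
proof -
  have "carrier T = (\<lambda>u. phiT (tau u)) ` PT"
    unfolding super_tensor_def by (auto simp: tensor_class_eq PT_def intro!: image_cong)
  then show ?thesis using tau_surj by (force simp: image_iff)
qed

text \<open>The sign rule depends only on the parities of the two inner factors. Read off at basis
  indices it is the sign in \<open>twist_double\<close>, so the super product is the convolution for
  the doubled form.\<close>

lemma super_mult_coords:
  assumes "s \<in> carrier C \<times> carrier C" "t \<in> carrier C \<times> carrier C"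
  shows "(\<Sum>i\<in>{0, 1}. \<Sum>j\<in>{0, 1}. (-1) ^ (i * j) *
      pair_coords (fst s \<otimes>\<^bsub>C\<^esub> hom_part C (clifford_part n \<epsilon> Q) j (fst t),
        hom_part C (clifford_part n \<epsilon> Q) i (snd s) \<otimes>\<^bsub>C\<^esub> snd t) w) =
    conv (n + n) (double n q) (pair_coords s) (pair_coords t) w" (is "?L = ?R")
proof (cases "w \<in> Z2n (n + n)")
  case False
  then show ?thesis by (simp add: pair_coords_def conv_def)
next
  case w: True
  obtain a b c d where abcd: "s = (phi a, phi c)" "t = (phi b, phi d)"
    "a \<in> coords n" "b \<in> coords n" "c \<in> coords n" "d \<in> coords n"
    using assms by (auto simp: carrier_C)
  let ?x = "ix_fst n w" and ?y = "ix_snd n w"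
  let ?h = "\<lambda>j a x. if rho n x mod 2 = j then a x else (0::'k)"
  have h: "?h j a \<in> coords n" if "a \<in> coords n" for j and a :: "(nat \<Rightarrow> nat) \<Rightarrow> 'k"
    using that by (auto simp: coords_def)
  define A where "A j x = twist n q x (Z2n_add n x ?x) * a x * ?h j b (Z2n_add n x ?x)" for j x
  define D where "D i y = twist n q y (Z2n_add n y ?y) * ?h i c y * d (Z2n_add n y ?y)" for i y
  have "pair_coords (fst s \<otimes>\<^bsub>C\<^esub> hom_part C (clifford_part n \<epsilon> Q) j (fst t),
      hom_part C (clifford_part n \<epsilon> Q) i (snd s) \<otimes>\<^bsub>C\<^esub> snd t) w =
      (\<Sum>x\<in>Z2n n. \<Sum>y\<in>Z2n n. A j x * D i y)" if "i \<in> {0, 1}" "j \<in> {0, 1}" for i j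
  proof -
    have "pair_coords (fst s \<otimes>\<^bsub>C\<^esub> hom_part C (clifford_part n \<epsilon> Q) j (fst t),
      hom_part C (clifford_part n \<epsilon> Q) i (snd s) \<otimes>\<^bsub>C\<^esub> snd t) w =
      conv n q a (?h j b) ?x * conv n q (?h i c) d ?y"
      using w that abcd by (simp add: pair_coords_def hom_part_eq C_simps h)
    then show ?thesis using w by (simp add: conv_def A_def D_def sum_product)
  qed
  then have "?L = (\<Sum>i\<in>{0, 1}. \<Sum>j\<in>{0, 1}. (-1) ^ (i * j) * (\<Sum>x\<in>Z2n n. \<Sum>y\<in>Z2n n. A j x * D i y))"
    by (intro sum.cong) auto
  also have "\<dots> = (\<Sum>x\<in>Z2n n. \<Sum>y\<in>Z2n n. A 0 x * D 0 y + A 1 x * D 0 y + (A 0 x * D 1 y - A 1 x * D 1 y))"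
    by (simp add: sum.distrib sum_subtractf)
  \<comment> \<open>For fixed \<open>x\<close> and \<open>y\<close> at most one of the four terms
    survives: the one whose degrees are the parities of the indices at which \<open>c\<close> and
    \<open>b\<close> are evaluated.\<close>
  also have "\<dots> = (\<Sum>x\<in>Z2n n. \<Sum>y\<in>Z2n n. (-1) ^ (rho n y * rho n (Z2n_add n x ?x)) *
      (twist n q x (Z2n_add n x ?x) * twist n q y (Z2n_add n y ?y)) *
      (a x * c y) * (b (Z2n_add n x ?x) * d (Z2n_add n y ?y)))"
  proof (intro sum.cong refl)
    fix x y
    have sign: "(-1 :: 'k) ^ (k * l) = (if odd k \<and> odd l then -1 else 1)" for k l :: nat
      by (simp add: minus_one_power_iff)
    show "A 0 x * D 0 y + A 1 x * D 0 y + (A 0 x * D 1 y - A 1 x * D 1 y) =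
      (-1) ^ (rho n y * rho n (Z2n_add n x ?x)) *
      (twist n q x (Z2n_add n x ?x) * twist n q y (Z2n_add n y ?y)) *
      (a x * c y) * (b (Z2n_add n x ?x) * d (Z2n_add n y ?y))"
      unfolding A_def D_def
      by (cases "even (rho n y)"; cases "even (rho n (Z2n_add n x ?x))")
        (simp_all add: sign mod2_eq_if mult_ac)
  qed
  also have "\<dots> = ?R"
    using w by (subst sum_Z2n_double[symmetric])
      (simp add: conv_def twist_double pair_coords_def abcd mult_ac)
  finally show ?thesis .
qed

text \<open>Reduces to pure tensors by bilinearity. It also shows that the product of classes is
  independent of representatives, since \<open>tau u\<close> and \<open>tau v\<close> determine its
  coordinates.\<close>

lemma tau_super_mult_free:
  assumes "u \<in> PT" "v \<in> PT"
  shows "tau (super_mult_free C (clifford_part n \<epsilon> Q) C (clifford_part n \<epsilon> Q) u v) =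
    conv (n + n) (double n q) (tau u) (tau v)"
proof
  fix w
  let ?k = "Poly_Mapping.keys" and ?l = "Poly_Mapping.lookup"
  let ?m = "\<lambda>s t i j. pair_coords (fst s \<otimes>\<^bsub>C\<^esub> hom_part C (clifford_part n \<epsilon> Q) j (fst t),
        hom_part C (clifford_part n \<epsilon> Q) i (snd s) \<otimes>\<^bsub>C\<^esub> snd t) w"
  have "tau (super_mult_free C (clifford_part n \<epsilon> Q) C (clifford_part n \<epsilon> Q) u v) w =
    (\<Sum>s\<in>?k u. \<Sum>t\<in>?k v. \<Sum>i\<in>{0, 1}. \<Sum>j\<in>{0, 1}. (-1) ^ (i * j) * ?l u s * ?l v t * ?m s t i j)"
    unfolding super_mult_free_def case_prod_beta tau_linear prod.collapse ..
  also have "\<dots> = (\<Sum>s\<in>?k u. \<Sum>t\<in>?k v. ?l u s * (?l v t *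
      (\<Sum>i\<in>{0, 1}. \<Sum>j\<in>{0, 1}. (-1) ^ (i * j) * ?m s t i j)))"
    unfolding sum_distrib_left by (intro sum.cong refl) (simp only: mult_ac)
  also have "\<dots> = (\<Sum>s\<in>?k u. \<Sum>t\<in>?k v. ?l u s * (?l v t *
      conv (n + n) (double n q) (pair_coords s) (pair_coords t) w))"
  proof (intro sum.cong refl)
    fix s t assume "s \<in> ?k u" "t \<in> ?k v"
    then have "s \<in> carrier C \<times> carrier C" "t \<in> carrier C \<times> carrier C" using assms by (auto simp: PT_def)
    then show "?l u s * (?l v t * (\<Sum>i\<in>{0, 1}. \<Sum>j\<in>{0, 1}. (-1) ^ (i * j) * ?m s t i j)) =
      ?l u s * (?l v t * conv (n + n) (double n q) (pair_coords s) (pair_coords t) w)"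
      by (simp only: super_mult_coords)
  qed
  also have "\<dots> = conv (n + n) (double n q) (tau u) (tau v) w"
    by (simp only: tau_def lin_def[abs_def] conv_sum_left conv_sum_right sum_distrib_left)
  finally show "tau (super_mult_free C (clifford_part n \<epsilon> Q) C (clifford_part n \<epsilon> Q) u v) w =
    conv (n + n) (double n q) (tau u) (tau v) w" .
qed

lemma hom_part_closed:
  "X \<in> carrier C \<Longrightarrow> d \<in> {0, 1} \<Longrightarrow> hom_part C (clifford_part n \<epsilon> Q) d X \<in> carrier C"
  by (auto simp: carrier_C hom_part_eq coords_def intro!: imageI)

lemma super_mult_free_closed:
  assumes "u \<in> PT" "v \<in> PT"
  shows "super_mult_free C (clifford_part n \<epsilon> Q) C (clifford_part n \<epsilon> Q) u v \<in> PT"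
  unfolding super_mult_free_def case_prod_beta
  using assms by (intro PT_sum PT_closed C_closed hom_part_closed) (auto simp: PT_def)

lemma T_simps:
  "\<one>\<^bsub>T\<^esub> = phiT (delta (ix_zero (n + n)))"
  "s \<in> coords (n + n) \<Longrightarrow> t \<in> coords (n + n) \<Longrightarrow> phiT s \<oplus>\<^bsub>T\<^esub> phiT t = phiT (\<lambda>w. s w + t w)"
  "s \<in> coords (n + n) \<Longrightarrow> t \<in> coords (n + n) \<Longrightarrow>
    phiT s \<otimes>\<^bsub>T\<^esub> phiT t = phiT (conv (n + n) (double n q) s t)"
  "t \<in> coords (n + n) \<Longrightarrow> c \<odot>\<^bsub>T\<^esub> phiT t = phiT (\<lambda>w. c * t w)"
proof -
  have one: "ix_pair n (ix_zero n) (ix_zero n) = ix_zero (n + n)"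
    by (auto simp: ix_pair_def ix_zero_def fun_eq_iff)
  show "\<one>\<^bsub>T\<^esub> = phiT (delta (ix_zero (n + n)))"
    unfolding super_tensor_def tensor_def
    using PT_closed(5)[of "E (ix_zero n)" "E (ix_zero n)" 1]
    by (simp add: C_simps tensor_class_eq pair_coords_delta one)
  show "phiT s \<oplus>\<^bsub>T\<^esub> phiT t = phiT (\<lambda>w. s w + t w)"
    if "s \<in> coords (n + n)" "t \<in> coords (n + n)"
  proof -
    have "phiT s \<oplus>\<^bsub>T\<^esub> phiT t = (\<Union>u\<in>phiT s. \<Union>v\<in>phiT t. tensor_class C C (u + v))"
      by (simp add: super_tensor_def)
    also have "\<dots> = phiT (\<lambda>w. s w + t w)"
      using PT_closed(2) by (intro UN_const phiT_nonempty that) (auto simp: phiT_def tensor_class_eq)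
    finally show ?thesis .
  qed
  show "phiT s \<otimes>\<^bsub>T\<^esub> phiT t = phiT (conv (n + n) (double n q) s t)"
    if "s \<in> coords (n + n)" "t \<in> coords (n + n)"
  proof -
    have "phiT s \<otimes>\<^bsub>T\<^esub> phiT t = (\<Union>u\<in>phiT s. \<Union>v\<in>phiT t. tensor_class C C
        (super_mult_free C (clifford_part n \<epsilon> Q) C (clifford_part n \<epsilon> Q) u v))"
      by (simp add: super_tensor_def)
    also have "\<dots> = phiT (conv (n + n) (double n q) s t)"
    proof (intro UN_const phiT_nonempty that)
      fix u v assume "u \<in> phiT s" "v \<in> phiT t"
      then have "u \<in> PT" "tau u = s" "v \<in> PT" "tau v = t" unfolding phiT_def by blast+
      then show "tensor_class C C
          (super_mult_free C (clifford_part n \<epsilon> Q) C (clifford_part n \<epsilon> Q) u v) =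
          phiT (conv (n + n) (double n q) s t)"
        by (simp only: tensor_class_eq[OF super_mult_free_closed] tau_super_mult_free)
    qed
    finally show ?thesis .
  qed
  show "c \<odot>\<^bsub>T\<^esub> phiT t = phiT (\<lambda>w. c * t w)" if "t \<in> coords (n + n)"
  proof -
    have "c \<odot>\<^bsub>T\<^esub> phiT t = (\<Union>u\<in>phiT t. tensor_class C C (pm_scale c u))"
      by (simp add: super_tensor_def)
    also have "\<dots> = phiT (\<lambda>w. c * t w)"
      using PT_closed(4) by (intro UN_const phiT_nonempty that) (auto simp: phiT_def tensor_class_eq)
    finally show ?thesis .
  qed
qed

lemma phiT_alg_iso: "phiT \<in> alg_iso (coord_alg (n + n) (double n q)) T"
  unfolding alg_iso_def ring_iso_def
  by (auto simp: ring_hom_def carrier_T T_simps bij_betw_def inj_phiT)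

lemma tensor_E:
  assumes "x \<in> Z2n n" "y \<in> Z2n n"
  shows "tensor C C (E x) (E y) = phiT (delta (ix_pair n x y))"
  unfolding tensor_def using PT_closed(5)[of "E x" "E y" 1] assms
  by (simp add: tensor_class_eq pair_coords_delta)

end

section \<open>The action in coordinates\<close>

lemma minus_one_dot_add:
  assumes "x \<in> Z2n n" "y \<in> Z2n n" "z \<in> Z2n n"
  shows "(-1 :: 'a::comm_ring_1) ^ dot n (Z2n_add n x y) z = (-1) ^ dot n x z * (-1) ^ dot n y z"
proof -
  have "(\<Prod>i<n. (-1 :: 'a) ^ (Z2n_add n x y i * z i)) = (\<Prod>i<n. (-1) ^ (x i * z i) * (-1) ^ (y i * z i))"
  proof (rule prod.cong)
    fix i assume "i \<in> {..<n}"
    then show "(-1 :: 'a) ^ (Z2n_add n x y i * z i) = (-1) ^ (x i * z i) * (-1) ^ (y i * z i)"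
      by (simp flip: power_add) (rule minus_one_power_cong, auto)
  qed simp
  then show ?thesis by (simp add: dot_def power_sum prod.distrib)
qed

lemma dot_commute: "dot n x y = dot n y x"
  by (simp add: dot_def mult.commute)

lemma dot_self: "y \<in> Z2n n \<Longrightarrow> rho n y = dot n y y"
  unfolding rho_def dot_def by (rule sum.cong) (use Z2n_mem in fastforce)+

text \<open>An index common to \<open>x\<close> and \<open>y\<close> drops out of the sum twice. In
  an exponent of \<open>\<iota>\<close>, this difference \<open>2 * dot n x y\<close> turns into the
  sign \<open>(-1) ^ dot n x y\<close>.\<close>

lemma rho_add:
  assumes "x \<in> Z2n n" "y \<in> Z2n n"
  shows "rho n (Z2n_add n x y) + 2 * dot n x y = rho n x + rho n y"
proof -
  have "(\<Sum>i<n. Z2n_add n x y i + 2 * (x i * y i)) = (\<Sum>i<n. x i + y i)"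
  proof (rule sum.cong)
    fix i assume "i \<in> {..<n}"
    then show "Z2n_add n x y i + 2 * (x i * y i) = x i + y i"
      using Z2n_mem[OF assms(1), of i] Z2n_mem[OF assms(2), of i] by auto
  qed simp
  then show ?thesis by (simp add: rho_def dot_def sum.distrib sum_distrib_left)
qed

text \<open>Orthogonality of characters: if \<open>y i = 1\<close>, translating by the
  \<open>i\<close>-th unit vector negates every term, so the sum equals its own negative.\<close>

lemma sum_minus_one_dot:
  assumes "(2 :: 'k::field) \<noteq> 0" "y \<in> Z2n n"
  shows "(\<Sum>z\<in>Z2n n. (-1 :: 'k) ^ dot n y z) = (if y = ix_zero n then 2 ^ n else 0)"
proof (cases "y = ix_zero n")
  case True
  have "dot n (ix_zero n) z = 0" for z by (simp add: dot_def)
  moreover have "card (Z2n n) = 2 ^ n"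
  proof -
    have "card {0, 1 :: nat} = 2" by simp
    then show ?thesis unfolding Z2n_def by (subst card_PiE) (simp_all only: finite_lessThan prod_constant card_lessThan)
  qed
  ultimately show ?thesis using True by simp
next
  case False
  have "\<exists>i<n. y i \<noteq> 0"
  proof (rule ccontr)
    assume "\<not> (\<exists>i<n. y i \<noteq> 0)"
    then have "y = ix_zero n" by (intro Z2n_eqI[OF assms(2) ix_zero_closed]) auto
    then show False using False by simp
  qed
  then obtain i where i: "i < n" "y i \<noteq> 0" by blast
  then have "y i = 1" using Z2n_mem[OF assms(2) i(1)] by simp
  then have "dot n y (ix_unit n i) = (\<Sum>j<n. if j = i then 1 else 0)"
    unfolding dot_def by (intro sum.cong) auto
  then have u: "dot n (ix_unit n i) y = 1" using i by (simp add: dot_commute)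
  let ?S = "\<Sum>z\<in>Z2n n. (-1 :: 'k) ^ dot n y z"
  have "?S = (\<Sum>z\<in>Z2n n. (-1) ^ dot n y (Z2n_add n (ix_unit n i) z))"
    by (rule sum_Z2n_translate[symmetric])
  also have "\<dots> = - ?S"
    using assms(2) by (simp add: dot_commute[of n y] minus_one_dot_add u sum_negf)
  finally have "2 * ?S = 0" by (metis mult_2 add.right_inverse)
  then show ?thesis using assms(1) False by simp
qed

text \<open>The kernel \<open>(-1) ^ dot n y z\<close> is symmetric, so the transform is its own
  inverse up to \<open>2 ^ n\<close>. Both injectivity and surjectivity of the action rest on
  this.\<close>

lemma fourier_inversion:
  assumes "(2 :: 'k::field) \<noteq> 0" "y \<in> Z2n n"
  shows "(\<Sum>z\<in>Z2n n. (-1) ^ dot n y z * (\<Sum>y'\<in>Z2n n. (-1) ^ dot n y' z * f y')) = 2 ^ n * (f y :: 'k)"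
proof -
  have "(\<Sum>z\<in>Z2n n. (-1) ^ dot n y z * (\<Sum>y'\<in>Z2n n. (-1) ^ dot n y' z * f y')) =
    (\<Sum>z\<in>Z2n n. \<Sum>y'\<in>Z2n n. (-1) ^ dot n (Z2n_add n y y') z * f y')"
    using assms(2) by (simp add: sum_distrib_left minus_one_dot_add mult.assoc)
  also have "\<dots> = (\<Sum>y'\<in>Z2n n. (\<Sum>z\<in>Z2n n. (-1) ^ dot n (Z2n_add n y y') z) * f y')"
    by (subst sum.swap) (simp add: sum_distrib_right)
  also have "\<dots> = (\<Sum>y'\<in>Z2n n. if y' = y then 2 ^ n * f y else 0)"
    using assms by (intro sum.cong refl) (auto simp: sum_minus_one_dot Z2n_add_eq_iff)
  finally show ?thesis using assms(2) by simp
qed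

section \<open>The action on basis elements and its linear extension\<close>

definition act_scalar :: "nat \<Rightarrow> (nat \<Rightarrow> 'k::field) \<Rightarrow> 'k \<Rightarrow> (nat \<Rightarrow> nat) \<Rightarrow> (nat \<Rightarrow> nat) \<Rightarrow> 'k" where
  "act_scalar n q \<iota> w z =
     twist n q (ix_fst n w) (ix_snd n w) * twist n q (Z2n_add n (ix_fst n w) (ix_snd n w)) z *
     (-1) ^ dot n (ix_snd n w) z * \<iota> ^ rho n (ix_snd n w)"

definition act_ix :: "nat \<Rightarrow> (nat \<Rightarrow> nat) \<Rightarrow> (nat \<Rightarrow> nat) \<Rightarrow> nat \<Rightarrow> nat" where
  "act_ix n w z = Z2n_add n (Z2n_add n (ix_fst n w) (ix_snd n w)) z"

text \<open>Translation by a fixed element is an involution, so the index that \<open>w\<close>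
  carries to \<open>v\<close> is \<open>act_ix n w v\<close>.\<close>

definition coord_act ::
    "nat \<Rightarrow> (nat \<Rightarrow> 'k::field) \<Rightarrow> 'k \<Rightarrow> ((nat \<Rightarrow> nat) \<Rightarrow> 'k) \<Rightarrow> ((nat \<Rightarrow> nat) \<Rightarrow> 'k) \<Rightarrow> (nat \<Rightarrow> nat) \<Rightarrow> 'k"
  where "coord_act n q \<iota> t a = (\<lambda>v. if v \<in> Z2n n
    then \<Sum>w\<in>Z2n (n + n). act_scalar n q \<iota> w (act_ix n w v) * t w * a (act_ix n w v) else 0)"

lemma act_ix_closed [simp]: "act_ix n w z \<in> Z2n n"
  by (simp add: act_ix_def)

lemma act_ix_self [simp]: "z \<in> Z2n n \<Longrightarrow> act_ix n w (act_ix n w z) = z"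
  by (simp add: act_ix_def)

text \<open>The action law on basis elements. Exchanging \<open>e_y\<close> with \<open>e_x'\<close>
  costs the sign of \<open>twist_commute\<close>: its \<open>rho * rho\<close> part is the super
  sign, and its \<open>dot n y x'\<close> part is absorbed by the character of \<open>y\<close> at
  \<open>x' + y' + z\<close>. That character also yields \<open>(-1) ^ dot n y y'\<close>, which
  cancels against the sign coming from the powers of \<open>\<iota>\<close>.\<close>

lemma act_scalar_mult:
  assumes "w \<in> Z2n (n + n)" "w' \<in> Z2n (n + n)" "z \<in> Z2n n" "\<iota>\<^sup>2 = -1"
  shows "twist (n + n) (double n q) w w' * act_scalar n q \<iota> (Z2n_add (n + n) w w') z =
    act_scalar n q \<iota> w' z * act_scalar n q \<iota> w (act_ix n w' z)"
proof -
  define x y x' y' where xy: "x = ix_fst n w" "y = ix_snd n w" "x' = ix_fst n w'" "y' = ix_snd n w'"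
  have Z: "x \<in> Z2n n" "y \<in> Z2n n" "x' \<in> Z2n n" "y' \<in> Z2n n"
    using assms by (simp_all add: xy)
  let ?F = "twist n q" and ?p = "Z2n_add n" and ?s = "\<lambda>k. (-1 :: 'a) ^ k"
  have square: "?s k * ?s k = 1" for k by (simp flip: power_mult_distrib)
  have iota: "\<iota> ^ rho n y * \<iota> ^ rho n y' = ?s (dot n y y') * \<iota> ^ rho n (?p y y')"
  proof -
    have "\<iota> ^ rho n y * \<iota> ^ rho n y' = \<iota> ^ (rho n (?p y y') + 2 * dot n y y')"
      using rho_add[OF Z(2,4)] by (simp flip: power_add)
    also have "\<dots> = ?s (dot n y y') * \<iota> ^ rho n (?p y y')"
      by (simp add: power_add power_mult assms(4) mult.commute)
    finally show ?thesis .
  qed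
  \<comment> \<open>The product \<open>((e_x e_x') (e_y e_y')) e_z\<close> is turned into
    \<open>(e_x e_y) ((e_x' e_y') e_z)\<close>; five cocycle identities change the bracketing, and
    one commutation exchanges the middle factors.\<close>
  have twist: "?F x x' * ?F y y' * ?F (?p x x') (?p y y') * ?F (?p (?p x x') (?p y y')) z *
      ?s (rho n y * rho n x' + dot n y x') =
      ?F x y * ?F x' y' * ?F (?p x y) (?p (?p x' y') z) * ?F (?p x' y') z"
  proof -
    let ?e = "?s (rho n y * rho n x' + dot n y x')"
    have 1: "?F y y' * ?F (?p x x') (?p y y') = ?F (?p x x') y * ?F (?p x (?p x' y)) y'"
      using twist_cocycle[of "?p x x'" n y y' q] Z by (simp add: Z2n_add_assoc)
    have 2: "?F x x' * ?F (?p x x') y = ?F x' y * ?F x (?p x' y)"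
      using twist_cocycle[of x n x' y q] Z by simp
    have 3: "?F x' y * ?e = ?F y x'"
      using twist_commute[of n q y x'] by (simp add: mult.commute)
    have 4: "?F y x' * ?F x (?p x' y) = ?F x y * ?F (?p x y) x'"
      using twist_cocycle[of x n y x' q] Z by (simp add: Z2n_add_commute[of n x' y])
    have 5: "?F (?p x y) x' * ?F (?p x (?p x' y)) y' = ?F x' y' * ?F (?p x y) (?p x' y')"
      using twist_cocycle[of "?p x y" n x' y' q] Z
      by (simp add: Z2n_add_assoc Z2n_add_commute[of n x' y])
    have 6: "?F (?p x y) (?p x' y') * ?F (?p (?p x x') (?p y y')) z =
        ?F (?p x' y') z * ?F (?p x y) (?p (?p x' y') z)"
      using twist_cocycle[of "?p x y" n "?p x' y'" z q] Z assms(3)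
      by (simp add: Z2n_add_assoc Z2n_add_left_commute[of n x' y])
    have "?F x x' * ?F y y' * ?F (?p x x') (?p y y') * ?F (?p (?p x x') (?p y y')) z * ?e =
      ?F x x' * (?F y y' * ?F (?p x x') (?p y y')) * ?F (?p (?p x x') (?p y y')) z * ?e"
      by (simp only: mult.assoc)
    also have "\<dots> = (?F x x' * ?F (?p x x') y) * ?F (?p x (?p x' y)) y' *
        ?F (?p (?p x x') (?p y y')) z * ?e"
      unfolding 1 by (simp only: mult.assoc)
    also have "\<dots> = (?F x' y * ?e) * ?F x (?p x' y) * ?F (?p x (?p x' y)) y' *
        ?F (?p (?p x x') (?p y y')) z"
      unfolding 2 by (simp only: mult_ac)
    also have "\<dots> = (?F y x' * ?F x (?p x' y)) * ?F (?p x (?p x' y)) y' *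
        ?F (?p (?p x x') (?p y y')) z"
      unfolding 3 ..
    also have "\<dots> = ?F x y * (?F (?p x y) x' * ?F (?p x (?p x' y)) y') *
        ?F (?p (?p x x') (?p y y')) z"
      unfolding 4 by (simp only: mult.assoc)
    also have "\<dots> = ?F x y * ?F x' y' * (?F (?p x y) (?p x' y') * ?F (?p (?p x x') (?p y y')) z)"
      unfolding 5 by (simp only: mult.assoc)
    also have "\<dots> = ?F x y * ?F x' y' * ?F (?p x y) (?p (?p x' y') z) * ?F (?p x' y') z"
      unfolding 6 by (simp only: mult_ac)
    finally show ?thesis .
  qed
  have dot: "?s (dot n (?p y y') z) = ?s (dot n y z) * ?s (dot n y' z)"
    "?s (dot n y (?p (?p x' y') z)) = ?s (dot n y x') * ?s (dot n y y') * ?s (dot n y z)"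
    using Z assms(3) by (simp_all add: minus_one_dot_add dot_commute[of n y])
  let ?A = "?F x x' * ?F y y' * ?F (?p x x') (?p y y') * ?F (?p (?p x x') (?p y y')) z"
  let ?B = "?F x y * ?F x' y' * ?F (?p x y) (?p (?p x' y') z) * ?F (?p x' y') z"
  have "act_scalar n q \<iota> w' z * act_scalar n q \<iota> w (act_ix n w' z) =
    ?B * (?s (dot n y' z) * ?s (dot n y (?p (?p x' y') z))) * (\<iota> ^ rho n y * \<iota> ^ rho n y')"
    unfolding act_scalar_def act_ix_def xy[symmetric] by (simp only: mult_ac)
  also have "\<dots> = ?B * (?s (dot n y x') * ?s (dot n y z) * ?s (dot n y' z)) *
      (?s (dot n y y') * ?s (dot n y y')) * \<iota> ^ rho n (?p y y')"
    unfolding iota dot by (simp only: mult_ac)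
  also have "\<dots> = ?A * (?s (rho n y * rho n x') * ?s (dot n y x')) *
      (?s (dot n y x') * ?s (dot n y z) * ?s (dot n y' z)) * 1 * \<iota> ^ rho n (?p y y')"
    unfolding twist[symmetric] square power_add ..
  also have "\<dots> = ?A * ?s (rho n y * rho n x') * (?s (dot n y z) * ?s (dot n y' z)) *
      (?s (dot n y x') * ?s (dot n y x')) * \<iota> ^ rho n (?p y y')"
    by (simp only: mult_ac mult_1_left)
  also have "\<dots> = twist (n + n) (double n q) w w' * act_scalar n q \<iota> (Z2n_add (n + n) w w') z"
    unfolding act_scalar_def twist_double ix_fst_add ix_snd_add xy[symmetric] dot square
    by (simp only: mult_ac mult_1_left)
  finally show ?thesis by (rule sym)
qed

lemma coord_act_closed [simp]: "coord_act n q \<iota> t a \<in> coords n"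
  by (simp add: coords_def coord_act_def)

lemma coord_act_delta:
  assumes "w \<in> Z2n (n + n)" "z \<in> Z2n n"
  shows "coord_act n q \<iota> (delta w) (delta z) = (\<lambda>v. act_scalar n q \<iota> w z * delta (act_ix n w z) v)"
proof
  fix v
  have "(\<Sum>u\<in>Z2n (n + n). act_scalar n q \<iota> u (act_ix n u v) * delta w u * delta z (act_ix n u v)) =
    (\<Sum>u\<in>Z2n (n + n). if u = w then act_scalar n q \<iota> w (act_ix n w v) * delta z (act_ix n w v) else 0)"
    by (rule sum.cong) (auto simp: delta_def)
  then have "coord_act n q \<iota> (delta w) (delta z) v =
      (if v \<in> Z2n n then act_scalar n q \<iota> w (act_ix n w v) * delta z (act_ix n w v) else 0)"
    using assms by (simp add: coord_act_def)
  then show "coord_act n q \<iota> (delta w) (delta z) v = act_scalar n q \<iota> w z * delta (act_ix n w z) v"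
    using assms by (auto simp: delta_def)
qed

lemma coord_act_sum_left:
  "coord_act n q \<iota> (\<lambda>w. \<Sum>i\<in>A. c i * f i w) a = (\<lambda>v. \<Sum>i\<in>A. c i * coord_act n q \<iota> (f i) a v)"
proof
  fix v
  have "(\<Sum>w\<in>Z2n (n + n). act_scalar n q \<iota> w (act_ix n w v) * (\<Sum>i\<in>A. c i * f i w) * a (act_ix n w v)) =
    (\<Sum>w\<in>Z2n (n + n). \<Sum>i\<in>A. c i * (act_scalar n q \<iota> w (act_ix n w v) * f i w * a (act_ix n w v)))"
    unfolding sum_distrib_left sum_distrib_right by (intro sum.cong refl) (simp add: mult_ac)
  then show "coord_act n q \<iota> (\<lambda>w. \<Sum>i\<in>A. c i * f i w) a v = (\<Sum>i\<in>A. c i * coord_act n q \<iota> (f i) a v)"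
    unfolding coord_act_def by (subst (asm) sum.swap) (simp add: sum_distrib_left)
qed

lemma coord_act_sum_right:
  "coord_act n q \<iota> t (\<lambda>z. \<Sum>i\<in>A. c i * f i z) = (\<lambda>v. \<Sum>i\<in>A. c i * coord_act n q \<iota> t (f i) v)"
proof
  fix v
  have "(\<Sum>w\<in>Z2n (n + n). act_scalar n q \<iota> w (act_ix n w v) * t w * (\<Sum>i\<in>A. c i * f i (act_ix n w v))) =
    (\<Sum>w\<in>Z2n (n + n). \<Sum>i\<in>A. c i * (act_scalar n q \<iota> w (act_ix n w v) * t w * f i (act_ix n w v)))"
    unfolding sum_distrib_left by (intro sum.cong refl) (simp add: mult_ac)
  then show "coord_act n q \<iota> t (\<lambda>z. \<Sum>i\<in>A. c i * f i z) v = (\<Sum>i\<in>A. c i * coord_act n q \<iota> t (f i) v)"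
    unfolding coord_act_def by (subst (asm) sum.swap) (simp add: sum_distrib_left)
qed

lemma coord_act_add:
  "coord_act n q \<iota> (\<lambda>w. s w + t w) a = (\<lambda>v. coord_act n q \<iota> s a v + coord_act n q \<iota> t a v)"
  "coord_act n q \<iota> t (\<lambda>z. a z + b z) = (\<lambda>v. coord_act n q \<iota> t a v + coord_act n q \<iota> t b v)"
  by (auto simp: coord_act_def distrib_left distrib_right sum.distrib)

lemma coord_act_scale:
  "coord_act n q \<iota> (\<lambda>w. c * t w) a = (\<lambda>v. c * coord_act n q \<iota> t a v)"
  "coord_act n q \<iota> t (\<lambda>z. c * a z) = (\<lambda>v. c * coord_act n q \<iota> t a v)"
  using coord_act_sum_left[where A = "{()}" and c = "\<lambda>_. c" and f = "\<lambda>_. t"]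
    coord_act_sum_right[where A = "{()}" and c = "\<lambda>_. c" and f = "\<lambda>_. a"] by simp_all

lemma coord_act_mult:
  assumes "s \<in> coords (n + n)" "t \<in> coords (n + n)" "a \<in> coords n" "\<iota>\<^sup>2 = -1"
  shows "coord_act n q \<iota> (conv (n + n) (double n q) s t) a = coord_act n q \<iota> s (coord_act n q \<iota> t a)"
proof -
  let ?c = "conv (n + n) (double n q)" and ?a = "coord_act n q \<iota>"
  have basis: "?a (?c (delta w) (delta w')) (delta z) = ?a (delta w) (?a (delta w') (delta z))"
    if "w \<in> Z2n (n + n)" "w' \<in> Z2n (n + n)" "z \<in> Z2n n" for w w' z
  proof -
    have "act_ix n (Z2n_add (n + n) w w') z = act_ix n w (act_ix n w' z)"
      by (simp add: act_ix_def Z2n_add_ac)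
    then show ?thesis
      using that
      by (simp add: conv_delta coord_act_scale coord_act_delta act_scalar_mult assms(4) flip: mult.assoc)
  qed
  have "?a (?c s t) a = ?a (?c (\<lambda>y. \<Sum>w\<in>Z2n (n + n). s w * delta w y)
      (\<lambda>y. \<Sum>w\<in>Z2n (n + n). t w * delta w y)) (\<lambda>y. \<Sum>z\<in>Z2n n. a z * delta z y)"
    using assms(1-3) by (simp flip: coords_expand)
  also have "\<dots> = (\<lambda>v. \<Sum>w\<in>Z2n (n + n). s w * (\<Sum>w'\<in>Z2n (n + n). t w' * (\<Sum>z\<in>Z2n n. a z *
      ?a (?c (delta w) (delta w')) (delta z) v)))"
    by (simp only: conv_sum_left conv_sum_right coord_act_sum_left coord_act_sum_right)
  also have "\<dots> = (\<lambda>v. \<Sum>w\<in>Z2n (n + n). s w * (\<Sum>w'\<in>Z2n (n + n). t w' * (\<Sum>z\<in>Z2n n. a z *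
      ?a (delta w) (?a (delta w') (delta z)) v)))"
    by (simp add: basis)
  also have "\<dots> = ?a (\<lambda>y. \<Sum>w\<in>Z2n (n + n). s w * delta w y)
      (?a (\<lambda>y. \<Sum>w\<in>Z2n (n + n). t w * delta w y) (\<lambda>y. \<Sum>z\<in>Z2n n. a z * delta z y))"
    by (simp only: coord_act_sum_left coord_act_sum_right)
  also have "\<dots> = ?a s (?a t a)"
    using assms(1-3) by (simp flip: coords_expand)
  finally show ?thesis .
qed

lemma coord_act_one:
  assumes "a \<in> coords n"
  shows "coord_act n q \<iota> (delta (ix_zero (n + n))) a = a"
proof -
  have "rho n (ix_zero n) = 0" "dot n (ix_zero n) z = 0" for z by (simp_all add: rho_def dot_def)
  then have *: "coord_act n q \<iota> (delta (ix_zero (n + n))) (delta z) = delta z" if "z \<in> Z2n n" for z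
    using that by (simp add: coord_act_delta act_scalar_def act_ix_def)
  have "coord_act n q \<iota> (delta (ix_zero (n + n))) (\<lambda>y. \<Sum>z\<in>Z2n n. a z * delta z y) =
      (\<lambda>y. \<Sum>z\<in>Z2n n. a z * delta z y)"
    unfolding coord_act_sum_right by (simp add: *)
  then show ?thesis using coords_expand[OF assms] by simp
qed

text \<open>For fixed \<open>u = x + y\<close> the matrix entries of \<open>t\<close> are a Fourier transform in \<open>y\<close>, up to
  nonzero factors.\<close>

lemma coord_act_entry:
  assumes "u \<in> Z2n n" "z \<in> Z2n n"
  shows "coord_act n q \<iota> t (delta z) (Z2n_add n u z) = twist n q u z *
    (\<Sum>y\<in>Z2n n. (-1) ^ dot n y z *
      (twist n q (Z2n_add n u y) y * \<iota> ^ rho n y * t (ix_pair n (Z2n_add n u y) y)))"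
proof -
  \<comment> \<open>The contribution of \<open>e_x \<otimes> e_y\<close>: it reaches
    \<open>e_(u+z)\<close> from \<open>e_z\<close> only if \<open>x + y = u\<close>. The double sum
    thus collapses to \<open>x = u + y\<close>.\<close>
  define g where "g x y = (if Z2n_add n x y = u then
      twist n q x y * twist n q u z * (-1) ^ dot n y z * \<iota> ^ rho n y * t (ix_pair n x y) else 0)" for x y
  have eq: "act_ix n w (Z2n_add n u z) = z \<longleftrightarrow> Z2n_add n (ix_fst n w) (ix_snd n w) = u"
    if "w \<in> Z2n (n + n)" for w
    using that assms Z2n_add_eq_iff[of "Z2n_add n u z" n z "Z2n_add n (ix_fst n w) (ix_snd n w)"]
      Z2n_add_eq_iff[of u n "Z2n_add n (Z2n_add n (ix_fst n w) (ix_snd n w)) z" z]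
    by (auto simp: act_ix_def Z2n_add_commute[of n _ z])
  have "coord_act n q \<iota> t (delta z) (Z2n_add n u z) =
      (\<Sum>w\<in>Z2n (n + n). g (ix_fst n w) (ix_snd n w))"
  proof -
    have "act_scalar n q \<iota> w (act_ix n w (Z2n_add n u z)) * t w * delta z (act_ix n w (Z2n_add n u z)) =
        g (ix_fst n w) (ix_snd n w)" if "w \<in> Z2n (n + n)" for w
      using eq[OF that] that
      by (cases "act_ix n w (Z2n_add n u z) = z") (simp_all add: g_def delta_def act_scalar_def)
    then show ?thesis by (simp add: coord_act_def)
  qed
  also have "\<dots> = (\<Sum>x\<in>Z2n n. \<Sum>y\<in>Z2n n. g x y)"
    by (rule sum_Z2n_double)
  also have "\<dots> = (\<Sum>y\<in>Z2n n. \<Sum>x\<in>Z2n n. g x y)"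
    by (rule sum.swap)
  also have "\<dots> = (\<Sum>y\<in>Z2n n. g (Z2n_add n u y) y)"
  proof (rule sum.cong)
    fix y assume y: "y \<in> Z2n n"
    have "(\<Sum>x\<in>Z2n n. g x y) = (\<Sum>x\<in>Z2n n. if x = Z2n_add n u y then g x y else 0)"
      using y assms Z2n_add_eq_iff[of _ n u y]
      by (intro sum.cong) (auto simp: g_def Z2n_add_commute[of n _ y])
    then show "(\<Sum>x\<in>Z2n n. g x y) = g (Z2n_add n u y) y" by simp
  qed simp
  also have "\<dots> = (\<Sum>y\<in>Z2n n. twist n q u z * ((-1) ^ dot n y z *
      (twist n q (Z2n_add n u y) y * \<iota> ^ rho n y * t (ix_pair n (Z2n_add n u y) y))))"
    using assms by (intro sum.cong) (auto simp: g_def Z2n_add_assoc)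
  finally show ?thesis by (simp add: sum_distrib_left)
qed

section \<open>Every matrix arises from exactly one tensor\<close>

context
  fixes n :: nat and q :: "nat \<Rightarrow> 'k::field" and \<iota> :: 'k
  assumes two: "(2 :: 'k) \<noteq> 0" and q: "\<And>i. i < n \<Longrightarrow> q i \<noteq> 0" and iota: "\<iota> \<noteq> 0"
begin

text \<open>The matrix entries for the translation \<open>u = x + y\<close> vanish, hence so does
  the Fourier transform of \<open>f\<close>. By inversion \<open>f\<close> vanishes at
  \<open>y\<close>, where it is a nonzero multiple of \<open>t w\<close>.\<close>

lemma coord_act_inj:
  assumes "t \<in> coords (n + n)" "\<And>z. z \<in> Z2n n \<Longrightarrow> coord_act n q \<iota> t (delta z) = (\<lambda>v. 0)"
  shows "t = (\<lambda>w. 0)"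
proof
  fix w
  show "t w = 0"
  proof (cases "w \<in> Z2n (n + n)")
    case w: True
    let ?x = "ix_fst n w" and ?y = "ix_snd n w"
    define u where "u = Z2n_add n ?x ?y"
    define f where "f y = twist n q (Z2n_add n u y) y * \<iota> ^ rho n y * t (ix_pair n (Z2n_add n u y) y)" for y
    have "(\<Sum>y\<in>Z2n n. (-1) ^ dot n y z * f y) = 0" if "z \<in> Z2n n" for z
      using coord_act_entry[of u n z q \<iota> t] assms(2)[OF that] that twist_nonzero[OF q]
      by (simp add: u_def f_def)
    then have "2 ^ n * f ?y = 0"
      using fourier_inversion[OF two, of ?y n f] w by simp
    then have "f ?y = 0" using two by simp
    moreover have "Z2n_add n u ?y = ?x" using w by (simp add: u_def Z2n_add_assoc)
    ultimately show ?thesis using w iota twist_nonzero[OF q] by (simp add: f_def)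
  qed (use assms(1) in \<open>simp add: coords_def\<close>)
qed

lemma coord_act_surj:
  assumes closed: "\<And>a. a \<in> coords n \<Longrightarrow> g a \<in> coords n"
    and add: "\<And>a b. a \<in> coords n \<Longrightarrow> b \<in> coords n \<Longrightarrow> g (\<lambda>x. a x + b x) = (\<lambda>x. g a x + g b x)"
    and scale: "\<And>c a. a \<in> coords n \<Longrightarrow> g (\<lambda>x. c * a x) = (\<lambda>x. c * g a x)"
  shows "\<exists>t\<in>coords (n + n). \<forall>a\<in>coords n. coord_act n q \<iota> t a = g a"
proof -
  \<comment> \<open>\<open>coord_act_entry\<close> solved for \<open>t\<close>: \<open>h u\<close>
    is the prescribed entry without its twist, with the \<open>2 ^ n\<close> of Fourier inversion
    divided out in advance, and \<open>t\<close> is its transform divided by the remaining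
    factors.\<close>
  define h where "h u z = g (delta z) (Z2n_add n u z) / (2 ^ n * twist n q u z)" for u z
  define t where "t w = (if w \<in> Z2n (n + n) then
      (\<Sum>z\<in>Z2n n. (-1) ^ dot n z (ix_snd n w) * h (Z2n_add n (ix_fst n w) (ix_snd n w)) z) /
      (twist n q (ix_fst n w) (ix_snd n w) * \<iota> ^ rho n (ix_snd n w)) else 0)" for w
  have t: "t \<in> coords (n + n)" by (simp add: coords_def t_def)
  have entry: "coord_act n q \<iota> t (delta z) (Z2n_add n u z) = g (delta z) (Z2n_add n u z)"
    if "u \<in> Z2n n" "z \<in> Z2n n" for u z
  proof -
    have "twist n q (Z2n_add n u y) y * \<iota> ^ rho n y * t (ix_pair n (Z2n_add n u y) y) =
        (\<Sum>z'\<in>Z2n n. (-1) ^ dot n z' y * h u z')" if "y \<in> Z2n n" for y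
      using that \<open>u \<in> Z2n n\<close> iota twist_nonzero[OF q]
      by (simp add: t_def Z2n_add_assoc)
    then have "coord_act n q \<iota> t (delta z) (Z2n_add n u z) = twist n q u z *
        (\<Sum>y\<in>Z2n n. (-1) ^ dot n z y * (\<Sum>z'\<in>Z2n n. (-1) ^ dot n z' y * h u z'))"
      using that by (simp add: coord_act_entry dot_commute[of n z])
    also have "\<dots> = twist n q u z * (2 ^ n * h u z)"
      by (simp only: fourier_inversion[OF two that(2)])
    also have "\<dots> = g (delta z) (Z2n_add n u z)"
      using two twist_nonzero[OF q] by (simp add: h_def)
    finally show ?thesis .
  qed
  have delta: "coord_act n q \<iota> t (delta z) = g (delta z)" if z: "z \<in> Z2n n" for z
  proof
    fix v
    show "coord_act n q \<iota> t (delta z) v = g (delta z) v"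
    proof (cases "v \<in> Z2n n")
      case True
      then show ?thesis using entry[of "Z2n_add n v z" z] z by (simp add: Z2n_add_assoc)
    next
      case False
      then show ?thesis using closed[OF coords_closed(4)[OF z]] by (simp add: coords_def coord_act_def)
    qed
  qed
  have g_zero: "g (\<lambda>x. 0) = (\<lambda>x. 0)" using scale[of "\<lambda>x. 0" 0] by simp
  have g_sum: "g (\<lambda>x. \<Sum>z\<in>A. c z * delta z x) = (\<lambda>x. \<Sum>z\<in>A. c z * g (delta z) x)"
    if "finite A" "A \<subseteq> Z2n n" for A c
    using that
  proof (induction A)
    case empty
    then show ?case by (simp add: g_zero)
  next
    case (insert z A)
    then have "z \<in> Z2n n" "(\<lambda>x. \<Sum>z\<in>A. c z * delta z x) \<in> coords n"
      by (auto intro!: coords_sum coords_closed)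
    then show ?case using insert by (simp add: add scale)
  qed
  have "coord_act n q \<iota> t a = g a" if "a \<in> coords n" for a
  proof -
    have "coord_act n q \<iota> t (\<lambda>y. \<Sum>z\<in>Z2n n. a z * delta z y) = g (\<lambda>y. \<Sum>z\<in>Z2n n. a z * delta z y)"
      unfolding coord_act_sum_right g_sum[OF finite_Z2n subset_refl] by (simp add: delta)
    then show ?thesis using coords_expand[OF that] by simp
  qed
  then show ?thesis using t by blast
qed

end

section \<open>The action on the Clifford algebra\<close>

context clifford_gens
begin

context
  fixes \<iota> :: 'k
  assumes two: "(2 :: 'k) \<noteq> 0" and iota: "\<iota>\<^sup>2 = -1" and q_nonzero: "\<And>i. i < n \<Longrightarrow> q i \<noteq> 0"
begin

definition kappaT where "kappaT = the_inv_into (coords (n + n)) phiT"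

definition act where "act X m = phi (coord_act n q \<iota> (kappaT X) (kappa m))"

lemma kappaT_phiT [simp]: "t \<in> coords (n + n) \<Longrightarrow> kappaT (phiT t) = t"
  by (simp add: kappaT_def the_inv_into_f_f inj_phiT)

lemma iota_nonzero: "\<iota> \<noteq> 0"
  using iota by auto

lemma act_phi [simp]:
  "t \<in> coords (n + n) \<Longrightarrow> a \<in> coords n \<Longrightarrow> act (phiT t) (phi a) = phi (coord_act n q \<iota> t a)"
  by (simp add: act_def)

lemma alg_action_act: "alg_action T C act"
  unfolding alg_action_def
  by (auto simp: carrier_C carrier_T C_simps T_simps coord_act_add coord_act_scale coord_act_mult
      coord_act_one iota)

lemma act_tensor:
  assumes "x \<in> Z2n n" "y \<in> Z2n n" "z \<in> Z2n n"
  shows "act (tensor C C (E x) (E y)) (E z) =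
      ((-1) ^ dot n y z * \<iota> ^ rho n y) \<odot>\<^bsub>C\<^esub> (E x \<otimes>\<^bsub>C\<^esub> E y \<otimes>\<^bsub>C\<^esub> E z)" (is ?A)
    and "((-1) ^ dot n y z * \<iota> ^ rho n y) \<odot>\<^bsub>C\<^esub> (E x \<otimes>\<^bsub>C\<^esub> E y \<otimes>\<^bsub>C\<^esub> E z) =
      (twist n q x y * twist n q (Z2n_add n x y) z * (-1) ^ dot n y z * \<iota> ^ rho n y) \<odot>\<^bsub>C\<^esub>
        E (Z2n_add n (Z2n_add n x y) z)" (is ?B)
proof -
  show B: ?B
  proof -
    have "E x \<otimes>\<^bsub>C\<^esub> E y \<otimes>\<^bsub>C\<^esub> E z =
        phi (\<lambda>v. twist n q x y * (twist n q (Z2n_add n x y) z * delta (Z2n_add n (Z2n_add n x y) z) v))"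
      using assms by (simp add: C_simps conv_delta conv_scale_left)
    then show ?thesis by (simp add: C_simps) (simp add: mult_ac)
  qed
  have "act (tensor C C (E x) (E y)) (E z) =
      (twist n q x y * twist n q (Z2n_add n x y) z * (-1) ^ dot n y z * \<iota> ^ rho n y) \<odot>\<^bsub>C\<^esub>
        E (Z2n_add n (Z2n_add n x y) z)"
    using assms by (simp add: tensor_E coord_act_delta act_scalar_def act_ix_def C_simps)
  then show ?A using B by simp
qed

lemma irreducible_act: "irreducible_action T C act"
  unfolding irreducible_action_def
proof (intro conjI allI impI)
  have "delta (ix_zero n) \<noteq> (\<lambda>x. 0 :: 'k)" by (auto simp: delta_def fun_eq_iff)
  then have "E (ix_zero n) \<noteq> \<zero>\<^bsub>C\<^esub>" using inj_phi by (auto simp: C_simps dest: inj_onD)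
  then show "carrier C \<noteq> {\<zero>\<^bsub>C\<^esub>}" using phi_closed[of "delta (ix_zero n)"] by auto
next
  fix W
  assume W: "subgroup W (add_monoid C) \<and> (\<forall>c. \<forall>w\<in>W. c \<odot>\<^bsub>C\<^esub> w \<in> W) \<and>
    (\<forall>X\<in>carrier T. \<forall>w\<in>W. act X w \<in> W)"
  then have sub: "W \<subseteq> carrier C" and zero: "\<zero>\<^bsub>C\<^esub> \<in> W"
    using subgroup.subset[of W "add_monoid C"] subgroup.one_closed[of W "add_monoid C"] by auto
  show "W = {\<zero>\<^bsub>C\<^esub>} \<or> W = carrier C"
  proof (rule disjCI)
    assume "W \<noteq> carrier C"
    show "W = {\<zero>\<^bsub>C\<^esub>}"
    proof (rule ccontr)
      assume "W \<noteq> {\<zero>\<^bsub>C\<^esub>}"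
      then obtain m where m: "m \<in> W" "m \<noteq> \<zero>\<^bsub>C\<^esub>" using zero by blast
      then obtain a where a: "m = phi a" "a \<in> coords n" using sub by (auto simp: carrier_C)
      then have "a \<noteq> (\<lambda>x. 0)" using m(2) C_simps(1) by auto
      then obtain z where z: "a z \<noteq> 0" by (auto simp: fun_eq_iff)
      have "phi b \<in> W" if b: "b \<in> coords n" for b
      proof -
        \<comment> \<open>The linear map that reads off the \<open>z\<close>-th coordinate,
          normalised to 1 at \<open>a\<close>, and multiplies \<open>b\<close> by it; it sends
          \<open>a\<close> to the arbitrary target \<open>b\<close>.\<close>
        have "\<exists>t\<in>coords (n + n). \<forall>d\<in>coords n. coord_act n q \<iota> t d = (\<lambda>x. d z / a z * b x)"
          using b by (intro coord_act_surj two q_nonzero iota_nonzero)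
            (auto simp: coords_def add_divide_distrib distrib_right)
        then obtain t where t: "t \<in> coords (n + n)" "coord_act n q \<iota> t a = b"
          using a(2) z by auto
        then have "act (phiT t) m \<in> W" using W m(1) by (auto simp: carrier_T)
        then show ?thesis using t a by simp
      qed
      then have "W = carrier C" using sub by (auto simp: carrier_C)
      then show False using \<open>W \<noteq> carrier C\<close> by simp
    qed
  qed
qed

lemma act_endomorphism_iso: "(\<lambda>X. \<lambda>m\<in>carrier C. act X m) \<in> alg_iso T (End_alg C)"
proof -
  let ?h = "\<lambda>X. \<lambda>m\<in>carrier C. act X m"
  note action = alg_action_act[unfolded alg_action_def]
  have T_closed: "X \<otimes>\<^bsub>T\<^esub> Y \<in> carrier T" "X \<oplus>\<^bsub>T\<^esub> Y \<in> carrier T"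
    if "X \<in> carrier T" "Y \<in> carrier T" for X Y
    using that by (auto simp: carrier_T T_simps)
  have End: "?h X \<in> carrier (End_alg C)" if "X \<in> carrier T" for X
    using that action by (auto simp: End_alg_def C_closed)
  have "?h \<in> ring_hom T (End_alg C)"
    using action End
    by (intro ring_hom_memI) (auto simp: End_alg_def compose_def fun_eq_iff T_closed)
  moreover have "bij_betw ?h (carrier T) (carrier (End_alg C))"
    unfolding bij_betw_def
  proof
    show "inj_on ?h (carrier T)"
    proof (rule inj_onI)
      fix X Y assume XY: "X \<in> carrier T" "Y \<in> carrier T" "?h X = ?h Y"
      then obtain s t where st: "X = phiT s" "Y = phiT t" "s \<in> coords (n + n)" "t \<in> coords (n + n)"
        by (auto simp: carrier_T)
      \<comment> \<open>The difference is written with a factor \<open>-1\<close> to fit the rules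
        for sums and multiples.\<close>
      have "coord_act n q \<iota> (\<lambda>w. s w + (-1) * t w) (delta z) = (\<lambda>v. 0)" if "z \<in> Z2n n" for z
      proof -
        have "act X (E z) = act Y (E z)"
          using fun_cong[OF XY(3), of "E z"] that by simp
        then have "coord_act n q \<iota> s (delta z) = coord_act n q \<iota> t (delta z)"
          using st that inj_onD[OF inj_phi] by simp
        then show ?thesis unfolding coord_act_add coord_act_scale by simp
      qed
      then have "(\<lambda>w. s w + (-1) * t w) = (\<lambda>w. 0)"
        using coord_act_inj[of n q \<iota> "\<lambda>w. s w + (-1) * t w"] two q_nonzero iota_nonzero
          coords_closed(2)[OF st(3) coords_closed(3)[OF st(4)]] by blast
      then have "s = t" by (auto simp: fun_eq_iff)
      then show "X = Y" using st by simp
    qed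
    show "?h ` carrier T = carrier (End_alg C)"
    proof
      show "carrier (End_alg C) \<subseteq> ?h ` carrier T"
      proof
        fix f assume f: "f \<in> carrier (End_alg C)"
        then have f_closed: "f m \<in> carrier C" if "m \<in> carrier C" for m
          using that by (auto simp: End_alg_def)
        have "\<exists>t\<in>coords (n + n). \<forall>a\<in>coords n. coord_act n q \<iota> t a = kappa (f (phi a))"
        proof (intro coord_act_surj two q_nonzero iota_nonzero)
          show "kappa (f (phi a)) \<in> coords n" if "a \<in> coords n" for a
            using that f_closed by simp
          show "kappa (f (phi (\<lambda>x. a x + b x))) = (\<lambda>x. kappa (f (phi a)) x + kappa (f (phi b)) x)"
            if "a \<in> coords n" "b \<in> coords n" for a b
          proof -
            have "f (phi a \<oplus>\<^bsub>C\<^esub> phi b) = f (phi a) \<oplus>\<^bsub>C\<^esub> f (phi b)"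
              using f that by (auto simp: End_alg_def)
            then show ?thesis using that f_closed by (simp add: C_simps kappa_simps)
          qed
          show "kappa (f (phi (\<lambda>x. c * a x))) = (\<lambda>x. c * kappa (f (phi a)) x)"
            if "a \<in> coords n" for c a
          proof -
            have "f (c \<odot>\<^bsub>C\<^esub> phi a) = c \<odot>\<^bsub>C\<^esub> f (phi a)"
              using f that by (auto simp: End_alg_def)
            then show ?thesis using that f_closed by (simp add: C_simps kappa_simps)
          qed
        qed
        then obtain t where t: "t \<in> coords (n + n)"
          "\<And>a. a \<in> coords n \<Longrightarrow> coord_act n q \<iota> t a = kappa (f (phi a))" by blast
        have "?h (phiT t) = f"
        proof
          fix m
          show "?h (phiT t) m = f m"
          proof (cases "m \<in> carrier C")
            case True
            then show ?thesis using t f_closed[OF True] by (simp add: act_def)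
          next
            case False
            \<comment> \<open>Elements of \<open>End_alg\<close> are extensional, so outside the
              carrier both sides are \<open>undefined\<close>.\<close>
            then show ?thesis using f by (auto simp: End_alg_def PiE_def extensional_def)
          qed
        qed
        then show "f \<in> ?h ` carrier T" using t(1) by (auto simp: carrier_T)
      qed
    qed (use End in blast)
  qed
  moreover have "?h (c \<odot>\<^bsub>T\<^esub> X) = c \<odot>\<^bsub>End_alg C\<^esub> ?h X" if "X \<in> carrier T" for c X
    using action that by (auto simp: End_alg_def fun_eq_iff)
  ultimately show ?thesis by (simp add: alg_iso_def ring_iso_def)
qed

end

end

section \<open>Composition of the isomorphisms\<close>

lemma alg_iso_comp:
  assumes "f \<in> alg_iso A B" "g \<in> alg_iso B D"
  shows "(\<lambda>x. g (f x)) \<in> alg_iso A D"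
proof -
  have "f x \<in> carrier B" if "x \<in> carrier A" for x
    using assms(1) that by (auto simp: alg_iso_def ring_iso_def ring_hom_def)
  then show ?thesis
    using assms bij_betw_trans[of f "carrier A" "carrier B" g "carrier D"]
    by (auto simp: alg_iso_def ring_iso_def ring_hom_def comp_def)
qed

text \<open>\<open>alg_iso\<close> does not say that the operations of \<open>A\<close> stay in its
  carrier, but the inverse can be evaluated on \<open>f (x \<otimes> y)\<close> only if
  \<open>x \<otimes> y\<close> lies there; hence the closure assumptions.\<close>

lemma alg_iso_inv:
  assumes f: "f \<in> alg_iso A B"
    and closed: "\<And>x y. x \<in> carrier A \<Longrightarrow> y \<in> carrier A \<Longrightarrow> x \<otimes>\<^bsub>A\<^esub> y \<in> carrier A"
      "\<And>x y. x \<in> carrier A \<Longrightarrow> y \<in> carrier A \<Longrightarrow> x \<oplus>\<^bsub>A\<^esub> y \<in> carrier A"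
      "\<And>c x. x \<in> carrier A \<Longrightarrow> c \<odot>\<^bsub>A\<^esub> x \<in> carrier A" "\<one>\<^bsub>A\<^esub> \<in> carrier A"
  shows "the_inv_into (carrier A) f \<in> alg_iso B A"
proof -
  have inj: "inj_on f (carrier A)" and B: "carrier B = f ` carrier A"
    using f by (auto simp: alg_iso_def ring_iso_def bij_betw_def)
  have eq: "f (x \<otimes>\<^bsub>A\<^esub> y) = f x \<otimes>\<^bsub>B\<^esub> f y" "f (x \<oplus>\<^bsub>A\<^esub> y) = f x \<oplus>\<^bsub>B\<^esub> f y"
    "f (c \<odot>\<^bsub>A\<^esub> x) = c \<odot>\<^bsub>B\<^esub> f x" "f \<one>\<^bsub>A\<^esub> = \<one>\<^bsub>B\<^esub>"
    if "x \<in> carrier A" "y \<in> carrier A" for x y c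
    using f that by (auto simp: alg_iso_def ring_iso_def ring_hom_def)
  have "bij_betw (the_inv_into (carrier A) f) (carrier B) (carrier A)"
    using f by (intro bij_betw_the_inv_into) (simp add: alg_iso_def ring_iso_def)
  then show ?thesis
    unfolding alg_iso_def ring_iso_def ring_hom_def
    using closed by (auto simp: B the_inv_into_f_f[OF inj] simp flip: eq)
qed

theorem corollary4p2:
  fixes scale :: "'k::field \<Rightarrow> 'v::ab_group_add \<Rightarrow> 'v"
    and Q :: "'v \<Rightarrow> 'k" and n :: nat and e :: "nat \<Rightarrow> 'v" and \<iota> :: 'k
  assumes "CHAR('k) \<noteq> 2"
    and "\<iota>\<^sup>2 = -1"
    and "vector_space scale"
    and "quadratic_form scale Q"
    and "nondegenerate Q"
    and "orthogonal_basis scale Q n e"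
    and "\<forall>i<n. Q (e i) \<noteq> 0"
  shows "let B = e ` {..<n};
             C = clifford B Q;
             BB = (\<lambda>v. (v, 0)) ` B \<union> (\<lambda>v. (0, v)) ` B;
             QQ = form_sum Q Q;
             CC = clifford BB QQ;
             G = clifford_part n e Q;
             T = super_tensor C G C G;
             F = twist n (\<lambda>i. Q (e i));
             E = clifford_mono n e Q
         in \<exists>\<Phi> act.
              \<Phi> \<in> alg_iso CC T \<and>
              (\<forall>i<n. \<Phi> (clifford_gen BB QQ (e i, 0)) = tensor C C (clifford_gen B Q (e i)) \<one>\<^bsub>C\<^esub> \<and>
                     \<Phi> (clifford_gen BB QQ (0, e i)) = tensor C C \<one>\<^bsub>C\<^esub> (clifford_gen B Q (e i))) \<and>
              alg_action T C act \<and>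
              (\<forall>x\<in>Z2n n. \<forall>y\<in>Z2n n. \<forall>z\<in>Z2n n.
                 act (tensor C C (E x) (E y)) (E z) =
                   ((-1) ^ dot n y z * \<iota> ^ rho n y) \<odot>\<^bsub>C\<^esub> (E x \<otimes>\<^bsub>C\<^esub> E y \<otimes>\<^bsub>C\<^esub> E z) \<and>
                 ((-1) ^ dot n y z * \<iota> ^ rho n y) \<odot>\<^bsub>C\<^esub> (E x \<otimes>\<^bsub>C\<^esub> E y \<otimes>\<^bsub>C\<^esub> E z) =
                   (F x y * F (Z2n_add n x y) z * (-1) ^ dot n y z * \<iota> ^ rho n y) \<odot>\<^bsub>C\<^esub>
                     E (Z2n_add n (Z2n_add n x y) z) \<and>
                 rho n y = dot n y y) \<and>
              irreducible_action T C act \<and>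
              (\<lambda>u. \<lambda>m\<in>carrier C. act (\<Phi> u) m) \<in> alg_iso CC (End_alg C)"
proof -
  have inj: "inj_on e {..<n}" using assms(6) by (simp add: orthogonal_basis_def)
  interpret V: vector_space scale by fact
  \<comment> \<open>Keeps the generators \<open>(e i, 0)\<close> and \<open>(0, e j)\<close>
    distinct, which the injectivity of \<open>ee\<close> requires.\<close>
  have nonzero: "e i \<noteq> 0" if "i < n" for i
  proof
    assume "e i = 0"
    then have "0 \<in> e ` {..<n}" using that by (metis imageI lessThan_iff)
    then show False
      using assms(6) V.dependent_zero[of "e ` {..<n}"] by (simp add: orthogonal_basis_def)
  qed
  \<comment> \<open>With \<open>Q 0 = 0\<close> the sum form takes the value \<open>Q (e i)\<close>
    on both copies of \<open>e i\<close>.\<close>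
  have "Q (scale 0 0) = 0\<^sup>2 * Q 0"
    using assms(4) unfolding quadratic_form_def by blast
  then have Q0: "Q 0 = 0" by simp
  have two: "(2 :: 'k) \<noteq> 0"
  proof
    assume "(2 :: 'k) = 0"
    then have "CHAR('k) dvd 2" using of_nat_eq_0_iff_char_dvd[of 2, where ?'a = 'k] by simp
    then have "CHAR('k) \<noteq> 0" "CHAR('k) \<le> 2"
      by (metis dvd_0_left_iff zero_neq_numeral) (use \<open>CHAR('k) dvd 2\<close> dvd_imp_le in auto)
    then show False using assms(1) CHAR_not_1[where ?'a = 'k] by linarith
  qed

  \<comment> \<open>The order matches \<open>double\<close> and the splitting of indices into
    halves, so that the Clifford algebra of the sum form and the super tensor product get literally
    the same coordinate algebra.\<close>
  define ee where "ee i = (if i < n then (e i, 0) else (0, e (i - n)))" for i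
  define BB where "BB = (\<lambda>v. (v, 0)) ` e ` {..<n} \<union> (\<lambda>v. (0, v)) ` e ` {..<n}"
  have BB: "ee ` {..<n + n} = BB"
  proof -
    have "{..<n + n} = {..<n} \<union> (+) n ` {..<n}"
    proof (intro equalityI subsetI)
      fix i assume "i \<in> {..<n + n}"
      then show "i \<in> {..<n} \<union> (+) n ` {..<n}"
        by (cases "i < n") (auto intro!: image_eqI[of _ _ "i - n"])
    qed auto
    then have "ee ` {..<n + n} = ee ` {..<n} \<union> (\<lambda>i. ee (n + i)) ` {..<n}"
      by (simp only: image_Un image_image)
    also have "\<dots> = (\<lambda>i. (e i, 0)) ` {..<n} \<union> (\<lambda>i. (0, e i)) ` {..<n}"
      by (intro arg_cong2[where f = "(\<union>)"] image_cong) (simp_all add: ee_def)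
    finally show ?thesis by (simp only: BB_def image_image)
  qed
  have QQ: "(\<lambda>i. form_sum Q Q (ee i)) = double n (\<lambda>i. Q (e i))"
    by (auto simp: form_sum_def ee_def double_def Q0)
  interpret C: clifford_gens n e Q
    by unfold_locales (rule inj)
  interpret D: clifford_gens "n + n" ee "form_sum Q Q"
  proof
    show "inj_on ee {..<n + n}"
    proof (rule inj_onI)
      fix i j assume ij: "i \<in> {..<n + n}" "j \<in> {..<n + n}" "ee i = ee j"
      show "i = j"
      proof (cases "i < n \<or> j < n")
        case True
        then show ?thesis
          using ij nonzero[of i] nonzero[of j] inj_onD[OF inj, of i j]
          by (auto simp: ee_def split: if_splits)
      next
        case False
        then have "e (i - n) = e (j - n)" "i - n < n" "j - n < n" using ij by (auto simp: ee_def)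
        then have "i - n = j - n" using inj_onD[OF inj] by auto
        then show ?thesis using False by linarith
      qed
    qed
  qed
  have psi: "D.phi \<in> alg_iso (coord_alg (n + n) (double n (\<lambda>i. Q (e i)))) (clifford BB (form_sum Q Q))"
    using D.phi_alg_iso by (simp add: BB QQ)
  \<comment> \<open>The identification passes through the common coordinates; on generators it is
    then just \<open>ix_unit_double\<close>.\<close>
  define \<Phi> where "\<Phi> X = C.phiT (the_inv_into (coords (n + n)) D.phi X)" for X
  have \<Phi>: "\<Phi> \<in> alg_iso (clifford BB (form_sum Q Q)) C.T"
    unfolding \<Phi>_def using alg_iso_comp[OF alg_iso_inv[OF psi] C.phiT_alg_iso] by simp
  have \<Phi>_phi: "\<Phi> (D.phi t) = C.phiT t" if "t \<in> coords (n + n)" for t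
    using that by (simp add: \<Phi>_def the_inv_into_f_f D.inj_phi)
  have ee: "ee i = (e i, 0)" "ee (n + i) = (0, e i)" if "i < n" for i
    using that by (simp_all add: ee_def)
  have gens: "\<Phi> (clifford_gen BB (form_sum Q Q) (e i, 0)) = tensor C.C C.C (clifford_gen C.B Q (e i)) \<one>\<^bsub>C.C\<^esub>"
    "\<Phi> (clifford_gen BB (form_sum Q Q) (0, e i)) = tensor C.C C.C \<one>\<^bsub>C.C\<^esub> (clifford_gen C.B Q (e i))"
    if "i < n" for i
    using that D.clifford_gen_eq[of i] D.clifford_gen_eq[of "n + i"] ee[of i]
    by (simp_all add: BB \<Phi>_phi C.clifford_gen_eq C.C_simps C.tensor_E ix_unit_double)
  have q: "\<And>i. i < n \<Longrightarrow> Q (e i) \<noteq> 0" using assms(7) by blast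
  show ?thesis
    unfolding Let_def BB_def[symmetric]
    by (intro exI[of _ \<Phi>] exI[of _ "C.act \<iota>"] conjI ballI allI impI \<Phi> gens
        C.alg_action_act[OF two assms(2) q] C.irreducible_act[OF two assms(2) q] dot_self
        alg_iso_comp[OF \<Phi> C.act_endomorphism_iso[OF two assms(2) q]])
      (simp_all add: C.clifford_mono_eq C.act_tensor[OF two assms(2) q])
qed

end
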